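(* For every positive integer $n$ and every permutation $w\in S_n$, the poset $(\mathrm{RPD}(w),\le)$ of reduced pipe dreams for $w$, ordered by generalized ladder moves (inverses of generalized chute moves), is a lattice; that is, every two elements of $\mathrm{RPD}(w)$ have a join (least upper bound) and a meet (greatest lower bound).
   Context: A pipe dream is a finite subset $D\subset \mathbb{Z}_{>0}\times\mathbb{Z}_{>0}$, in matrix coordinates ($(i,j)$ is row $i$ from the top, column $j$ from the left). Place a cross tile at each $(i,j)\in D$ (one strand joins the left and right edges, the other joins the top and bottom edges) and a bump tile at each $(i,j)\notin D$ (one strand joins the top edge to the left edge, the other joins the right edge to the bottom edge). Write $D(i,j)=+$ if $(i,j)\in D$ and $D(i,j)=\bullet$ otherwise. The strands form pipes going from the top boundary to the left boundary; pipe $x$ is the one entering at the top of column $x$. The permutation $w$ of $D$ is defined by: $w(i)$ is the label of the pipe that exits the left boundary in row $i$. Permutations $w\in S_n$ are regarded as permutations of $\mathbb{Z}_{>0}$ fixing all $m>n$. $\mathrm{RPD}(w)$ is the set of reduced pipe dreams for $w$: pipe dreams $D$ whose permutation is $w$ and such that $|D|$ equals the number of inversions of $w$. Generalized ladder move: let $D\in\mathrm{RPD}(w)$, and suppose there are $h<i$ and $j<k$ such that $D(i,j)=+$, $D(h,j)=D(i,k)=D(h,k)=\bullet$, and every other tile in the rectangle $[h,i]\times[j,k]$ is a $+$. Then $(i,j)$ is called ladder movable in $D$, and $\mathcal{L}_{ij}(D)\in\mathrm{RPD}(w)$ is obtained from $D$ by swapping the tiles at $(i,j)$ and $(h,k)$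 (given $(i,j)$, the pair $(h,k)$ is unique). The inverse of a generalized ladder move is a generalized chute move. Order: the partial order $\le$ on $\mathrm{RPD}(w)$ has covering relations $D\lessdot\mathcal{L}_{ij}(D)$ for $(i,j)$ ladder movable in $D$; i.e. $D\le D'$ iff $D'$ can be obtained from $D$ by a (possibly empty) sequence of generalized ladder moves. *)

theory Defs
  imports "HOL-Algebra.Lattice" "HOL-Combinatorics.Permutations"
begin

text \<open>
  Tiles are pairs \<open>(i, j)\<close> of positive natural numbers in matrix coordinates (row, column).
  A tile edge is one of
    \<^item> \<open>HEdge i j\<close>: the bottom edge of tile \<open>(i, j)\<close>, which is also the top edge of \<open>(i + 1, j)\<close>;
      thus \<open>HEdge 0 j\<close> is the part of the top boundary above column \<open>j\<close>;
    \<^item> \<open>VEdge i j\<close>: the right edge of tile \<open>(i, j)\<close>, which is also the left edge of \<open>(i, j + 1)\<close>;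
      thus \<open>VEdge i 0\<close> is the part of the left boundary in row \<open>i\<close>.
\<close>

datatype edge = HEdge nat nat | VEdge nat nat

type_synonym pipe_dream = "(nat \<times> nat) set"

definition is_pipe_dream :: "pipe_dream \<Rightarrow> bool" where
  "is_pipe_dream D \<longleftrightarrow> finite D \<and> D \<subseteq> {0<..} \<times> {0<..}"

text \<open>The two strands inside each tile, oriented from the top boundary towards the left boundary.\<close>

inductive strand :: "pipe_dream \<Rightarrow> edge \<Rightarrow> edge \<Rightarrow> bool" for D where
  cross_vertical:
    "\<lbrakk>0 < i; 0 < j; (i, j) \<in> D\<rbrakk> \<Longrightarrow> strand D (HEdge (i - 1) j) (HEdge i j)"
| cross_horizontal:
    "\<lbrakk>0 < i; 0 < j; (i, j) \<in> D\<rbrakk> \<Longrightarrow> strand D (VEdge i j) (VEdge i (j - 1))"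
| bump_top_left:
    "\<lbrakk>0 < i; 0 < j; (i, j) \<notin> D\<rbrakk> \<Longrightarrow> strand D (HEdge (i - 1) j) (VEdge i (j - 1))"
| bump_right_bottom:
    "\<lbrakk>0 < i; 0 < j; (i, j) \<notin> D\<rbrakk> \<Longrightarrow> strand D (VEdge i j) (HEdge i j)"

definition pipe_exits :: "pipe_dream \<Rightarrow> nat \<Rightarrow> nat \<Rightarrow> bool" where
  "pipe_exits D x i \<longleftrightarrow> 0 < x \<and> 0 < i \<and> (strand D)\<^sup>*\<^sup>* (HEdge 0 x) (VEdge i 0)"

text \<open>
  Every edge has at most one incoming strand, so at most one pipe exits in a given row, and the
  following predicate determines \<open>w\<close> on the positive integers.
\<close>

definition has_permutation :: "pipe_dream \<Rightarrow> (nat \<Rightarrow> nat) \<Rightarrow> bool" where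
  "has_permutation D w \<longleftrightarrow> (\<forall>i>0. pipe_exits D (w i) i)"

definition inversions :: "(nat \<Rightarrow> nat) \<Rightarrow> (nat \<times> nat) set" where
  "inversions w = {(a, b). 0 < a \<and> a < b \<and> w b < w a}"

definition RPD :: "(nat \<Rightarrow> nat) \<Rightarrow> pipe_dream set" where
  "RPD w = {D. is_pipe_dream D \<and> has_permutation D w \<and> card D = card (inversions w)}"

definition ladder_rectangle :: "pipe_dream \<Rightarrow> nat \<Rightarrow> nat \<Rightarrow> nat \<Rightarrow> nat \<Rightarrow> bool" where
  "ladder_rectangle D h i j k \<longleftrightarrow>
     0 < h \<and> h < i \<and> 0 < j \<and> j < k \<and>
     (i, j) \<in> D \<and> (h, j) \<notin> D \<and> (i, k) \<notin> D \<and> (h, k) \<notin> D \<and>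
     {h..i} \<times> {j..k} - {(h, j), (i, k), (h, k)} \<subseteq> D"

definition ladder_move :: "(nat \<Rightarrow> nat) \<Rightarrow> pipe_dream \<Rightarrow> pipe_dream \<Rightarrow> bool" where
  "ladder_move w D D' \<longleftrightarrow>
     D \<in> RPD w \<and> (\<exists>h i j k. ladder_rectangle D h i j k \<and> D' = insert (h, k) (D - {(i, j)}))"

definition RPD_poset :: "(nat \<Rightarrow> nat) \<Rightarrow> pipe_dream gorder" where
  "RPD_poset w = \<lparr>carrier = RPD w, eq = (=), le = (ladder_move w)\<^sup>*\<^sup>*\<rparr>"

end

theory Submission
  imports Defs
begin

text \<open>
  Induction on \<open>n\<close>, deleting the pipe \<open>n\<close> that enters in the last column. Since it starts to the right of
  all others, it is crossed only from above, so it is a staircase given by the columns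
  \<open>a 0 > a 1 > \<dots>\<close> in which it enters rows \<open>1, 2, \<dots>\<close> from above, and a reduced pipe dream
  becomes a pair \<open>(D, a)\<close> of a smaller reduced pipe dream \<open>D\<close> and such a sequence, where the only
  requirement is that \<open>(r, a r)\<close> is a bump of \<open>D\<close>. A ladder move either moves one \<open>a h\<close> to the next
  bump of \<open>D\<close> on its left, or is a ladder move of \<open>D\<close>, which is blocked exactly if its target is some
  \<open>(h, a h)\<close>. For fixed \<open>D\<close> the sequences \<open>a\<close> form a distributive lattice under pointwise comparison.

  Let \<open>west D r (a r)\<close> be the set of pipes still to the left of pipe \<open>n\<close> when it leaves row \<open>r\<close>. Then
  \<open>(D, a) \<le> (F, c)\<close> holds iff \<open>D \<le> F\<close> and \<open>west F r (c r) \<subseteq> west D r (a r)\<close> for all \<open>r\<close>;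
  moreover every \<open>D \<le> E \<le> F\<close> then factors through some \<open>(E, b)\<close>, with \<open>b\<close> depending only on \<open>D\<close>, \<open>a\<close>
  and \<open>E\<close>. The only obstruction to this is a blocked move, and it is excluded because the Lehmer
  code of the order of pipes below a row weakly increases along ladder moves. Hence the join of
  \<open>(D, a)\<close> and \<open>(D', a')\<close> is obtained by pushing \<open>a\<close> and \<open>a'\<close> to the join of \<open>D\<close> and \<open>D'\<close> and taking
  the pointwise minimum. Meets follow by finiteness, as any two elements have a common lower bound.
\<close>

section \<open>Pipes and reduced pipe dreams\<close>

text \<open>The strand on the right edge of tile \<open>(r, c)\<close> entered row \<open>r\<close>
  from above at the first bump to the right of column \<open>c\<close>.\<close>

definition nxt :: "pipe_dream \<Rightarrow> nat \<Rightarrow> nat \<Rightarrow> nat" where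
  "nxt D r c = (LEAST x. c < x \<and> (r, x) \<notin> D)"

text \<open>Pipes are traced backwards: the pipe leaving row \<open>r\<close> downwards in column
  \<open>c\<close> entered that row from above in column \<open>hop D r c\<close>.\<close>

definition hop :: "pipe_dream \<Rightarrow> nat \<Rightarrow> nat \<Rightarrow> nat" where
  "hop D r c = (if (r, c) \<in> D then c else nxt D r c)"

text \<open>
  \<open>state D r c\<close> is the pipe on the bottom edge of tile \<open>(r, c)\<close>. As column \<open>0\<close> never contains a cross,
  \<open>state D r 0\<close> is the pipe that exits in row \<open>r\<close>, for \<open>r > 0\<close>.
\<close>

fun state :: "pipe_dream \<Rightarrow> nat \<Rightarrow> nat \<Rightarrow> nat" where
  "state D 0 c = c"
| "state D (Suc r) c = state D r (hop D (Suc r) c)"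

lemma nxt_props:
  assumes "finite D"
  shows "c < nxt D r c" "(r, nxt D r c) \<notin> D" "\<And>y. c < y \<Longrightarrow> y < nxt D r c \<Longrightarrow> (r, y) \<in> D"
proof -
  have "finite (snd ` D)"
    using assms by simp
  then obtain b where b: "\<And>x. x \<in> snd ` D \<Longrightarrow> x < b"
    by (meson finite_nat_set_iff_bounded)
  have "c < max b (Suc c) \<and> (r, max b (Suc c)) \<notin> D"
    using b[of "max b (Suc c)"] by force
  then have *: "c < nxt D r c \<and> (r, nxt D r c) \<notin> D"
    unfolding nxt_def by (rule LeastI)
  then show "c < nxt D r c" "(r, nxt D r c) \<notin> D"
    by auto
  show "(r, y) \<in> D" if "c < y" "y < nxt D r c" for y
    using not_less_Least[of y "\<lambda>x. c < x \<and> (r, x) \<notin> D"] that unfolding nxt_def by auto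
qed

lemma nxt_eqI:
  assumes "c < x" "(r, x) \<notin> D" "\<And>y. c < y \<Longrightarrow> y < x \<Longrightarrow> (r, y) \<in> D"
  shows "nxt D r c = x"
  unfolding nxt_def by (rule Least_equality) (use assms in \<open>auto simp: not_less[symmetric]\<close>)

lemma nxt_le: "c < x \<Longrightarrow> (r, x) \<notin> D \<Longrightarrow> nxt D r c \<le> x"
  unfolding nxt_def by (rule Least_le) auto

lemma nxt_cong:
  assumes "\<And>x. c < x \<Longrightarrow> (r, x) \<in> D \<longleftrightarrow> (s, x) \<in> E"
  shows "nxt D r c = nxt E s c"
proof -
  have "(\<lambda>x. c < x \<and> (r, x) \<notin> D) = (\<lambda>x. c < x \<and> (s, x) \<notin> E)"
    using assms by auto
  then show ?thesis by (simp add: nxt_def)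
qed

lemma nxt_cong_upto:
  assumes "finite E" "\<And>x. c < x \<Longrightarrow> x \<le> b \<Longrightarrow> (r, x) \<in> D \<longleftrightarrow> (s, x) \<in> E" "c < b" "(s, b) \<notin> E"
  shows "nxt D r c = nxt E s c"
proof -
  have "nxt E s c \<le> b" using assms nxt_le by blast
  then show ?thesis
    by (intro nxt_eqI) (use assms nxt_props[OF assms(1), where r=s and c=c] in auto)
qed

lemma hop_ge: "finite D \<Longrightarrow> c \<le> hop D r c"
  using nxt_props(1)[of D c r] by (auto simp: hop_def)

lemma hop_inj:
  assumes "finite D" "hop D r c = hop D r c'"
  shows "c = c'"
proof (rule ccontr)
  assume "c \<noteq> c'"
  have *: False if "x < y" "hop D r x = hop D r y" for x y
  proof -
    have "y \<le> hop D r x" using hop_ge[OF assms(1), of y r] that by simp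
    then have x: "(r, x) \<notin> D" "hop D r x = nxt D r x"
      using that(1) by (auto simp: hop_def split: if_splits)
    show False
    proof (cases "(r, y) \<in> D")
      case True
      then show False
        using that(2) x nxt_props(2)[OF assms(1), of r x] by (simp add: hop_def)
    next
      case False
      have "y < nxt D r y" using nxt_props(1)[OF assms(1)] by simp
      moreover have "nxt D r x \<le> y" using nxt_le that(1) False by simp
      ultimately show False using that(2) x False by (simp add: hop_def)
    qed
  qed
  show False
    using *[of c c'] *[of c' c] \<open>c \<noteq> c'\<close> assms(2) by (metis linorder_neqE_nat)
qed

lemma state_inj: "finite D \<Longrightarrow> state D r c = state D r c' \<Longrightarrow> c = c'"
  by (induction r arbitrary: c c') (auto dest: hop_inj)

lemma state_pos: "finite D \<Longrightarrow> 0 < c \<Longrightarrow> 0 < state D r c"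
proof (induction r arbitrary: c)
  case (Suc r)
  then show ?case using hop_ge[of D c "Suc r"] by simp
qed simp

lemma state_zero_pos:
  assumes "finite D" "D \<subseteq> {0<..} \<times> {0<..}" "0 < r"
  shows "0 < state D r 0"
proof -
  obtain s where s: "r = Suc s" using assms(3) gr0_implies_Suc by blast
  have "(r, 0) \<notin> D" using assms(2) by auto
  then have "0 < hop D r 0" using nxt_props(1)[OF assms(1)] by (simp add: hop_def)
  then show ?thesis using state_pos[OF assms(1)] s by simp
qed

text \<open>Extends \<open>state\<close> to vertical edges so that labels are constant along
  strands; reachability then forces equal labels.\<close>

fun edge_label :: "pipe_dream \<Rightarrow> edge \<Rightarrow> nat" where
  "edge_label D (HEdge r c) = state D r c"
| "edge_label D (VEdge r c) = state D (r - 1) (nxt D r c)"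

lemma edge_label_strand:
  assumes "finite D" "strand D e f"
  shows "edge_label D e = edge_label D f"
  using assms(2)
proof cases
  case (cross_vertical i j)
  then show ?thesis by (cases i) (auto simp: hop_def)
next
  case (cross_horizontal i j)
  have "nxt D i (j - 1) = nxt D i j"
  proof (rule nxt_eqI)
    show "(i, y) \<in> D" if "j - 1 < y" "y < nxt D i j" for y
      using that cross_horizontal nxt_props(3)[OF assms(1), where r=i and c=j and y=y] by (cases "y = j") auto
  qed (use nxt_props[OF assms(1), where r=i and c=j] cross_horizontal in auto)
  then show ?thesis using cross_horizontal by simp
next
  case (bump_top_left i j)
  have "nxt D i (j - 1) = j"
    by (rule nxt_eqI) (use bump_top_left in auto)
  then show ?thesis using bump_top_left by simp
next
  case (bump_right_bottom i j)
  then show ?thesis by (cases i) (auto simp: hop_def)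
qed

lemma strand_path_along_row:
  assumes "finite D" "0 < r"
  shows "(strand D)\<^sup>*\<^sup>* (HEdge (r - 1) (nxt D r c)) (VEdge r c)"
proof -
  have "d < nxt D r c \<Longrightarrow> c \<le> d \<Longrightarrow> (strand D)\<^sup>*\<^sup>* (HEdge (r - 1) (nxt D r c)) (VEdge r d)" for d
  proof (induction "nxt D r c - d" arbitrary: d)
    case (Suc k)
    show ?case
    proof (cases "nxt D r c = Suc d")
      case True
      then have "strand D (HEdge (r - 1) (Suc d)) (VEdge r (Suc d - 1))"
        using nxt_props(2)[OF assms(1), of r c] assms(2) by (intro strand.bump_top_left) auto
      then show ?thesis using True by auto
    next
      case False
      then have "(strand D)\<^sup>*\<^sup>* (HEdge (r - 1) (nxt D r c)) (VEdge r (Suc d))"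
        using Suc by (intro Suc(1)) auto
      moreover have "strand D (VEdge r (Suc d)) (VEdge r (Suc d - 1))"
        using nxt_props(3)[OF assms(1), of c "Suc d" r] assms(2) Suc False
        by (intro strand.cross_horizontal) auto
      ultimately show ?thesis by (simp add: rtranclp.rtrancl_into_rtrancl)
    qed
  qed auto
  then show ?thesis using nxt_props(1)[OF assms(1)] by blast
qed

lemma strand_path_from_top:
  assumes "finite D"
  shows "0 < c \<Longrightarrow> (strand D)\<^sup>*\<^sup>* (HEdge 0 (state D r c)) (HEdge r c)"
proof (induction r arbitrary: c)
  case (Suc r)
  show ?case
  proof (cases "(Suc r, c) \<in> D")
    case True
    then have "strand D (HEdge (Suc r - 1) c) (HEdge (Suc r) c)"
      using Suc by (intro strand.cross_vertical) auto
    then show ?thesis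
      using Suc True by (auto simp: hop_def intro: rtranclp.rtrancl_into_rtrancl)
  next
    case False
    have "(strand D)\<^sup>*\<^sup>* (HEdge 0 (state D (Suc r) c)) (HEdge r (nxt D (Suc r) c))"
      using Suc.IH[of "nxt D (Suc r) c"] Suc.prems nxt_props(1)[OF assms, of c "Suc r"] False
      by (simp add: hop_def)
    also have "(strand D)\<^sup>*\<^sup>* (HEdge r (nxt D (Suc r) c)) (VEdge (Suc r) c)"
      using strand_path_along_row[OF assms, of "Suc r" c] by simp
    also have "strand D (VEdge (Suc r) c) (HEdge (Suc r) c)"
      using Suc.prems False by (intro strand.bump_right_bottom) auto
    finally show ?thesis .
  qed
qed auto

text \<open>Constancy of \<open>edge_label\<close> identifies any pipe that exits in row
  \<open>i\<close>; conversely, tracing \<open>state\<close> backwards yields an actual strand path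
  from the top.\<close>

lemma has_permutation_iff:
  assumes "is_pipe_dream D"
  shows "has_permutation D w \<longleftrightarrow> (\<forall>i>0. w i = state D i 0)"
proof -
  have fin: "finite D" and pos: "D \<subseteq> {0<..} \<times> {0<..}"
    using assms by (auto simp: is_pipe_dream_def)
  have exit: "state D i 0 = state D (i - 1) (nxt D i 0)" if "0 < i" for i
  proof -
    have "(i, 0) \<notin> D" using pos by auto
    with that show ?thesis by (cases i) (auto simp: hop_def)
  qed
  have "pipe_exits D x i \<longleftrightarrow> x = state D i 0" if "0 < i" for x i
  proof
    assume "pipe_exits D x i"
    then have "(strand D)\<^sup>*\<^sup>* (HEdge 0 x) (VEdge i 0)" by (simp add: pipe_exits_def)
    then have "edge_label D (HEdge 0 x) = edge_label D (VEdge i 0)"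
      by (induction rule: rtranclp_induct) (auto simp: edge_label_strand[OF fin])
    then show "x = state D i 0" using exit[OF that] by simp
  next
    assume x: "x = state D i 0"
    have "(strand D)\<^sup>*\<^sup>* (HEdge 0 x) (HEdge (i - 1) (nxt D i 0))"
      using strand_path_from_top[OF fin, of "nxt D i 0" "i - 1"] nxt_props(1)[OF fin, of 0 i]
        exit[OF that] x by simp
    then have "(strand D)\<^sup>*\<^sup>* (HEdge 0 x) (VEdge i 0)"
      using strand_path_along_row[OF fin that, of 0] by (rule rtranclp_trans)
    then show "pipe_exits D x i"
      using that x state_zero_pos[OF fin pos that] by (simp add: pipe_exits_def)
  qed
  then show ?thesis by (simp add: has_permutation_def)
qed

section \<open>Reduced pipe dreams inside a staircase\<close>

definition staircase :: "nat \<Rightarrow> (nat \<times> nat) set" where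
  "staircase n = {(r, c). 0 < r \<and> 0 < c \<and> r + c \<le> n}"

text \<open>At a cross the vertical pipe is \<open>state D r c\<close>, and the horizontal one
  entered the row in column \<open>nxt D (Suc r) c\<close>. Requiring their initial order there says
  that no crossing undoes an earlier one.\<close>

definition reduced :: "pipe_dream \<Rightarrow> bool" where
  "reduced D \<longleftrightarrow> (\<forall>r c. (Suc r, c) \<in> D \<longrightarrow> state D r c < state D r (nxt D (Suc r) c))"

definition RP :: "nat \<Rightarrow> pipe_dream set" where
  "RP n = {D. D \<subseteq> staircase n \<and> reduced D}"

lemma finite_staircase: "finite (staircase n)"
  by (rule finite_subset[of _ "{..n} \<times> {..n}"]) (auto simp: staircase_def)

text \<open>Both pipes are followed upwards from their exits. The one exiting in row
  \<open>b\<close> is on the right at the bottom of row \<open>a\<close> but on the left at the top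
  boundary; they cross in the first row at whose bottom it is on the right.\<close>

lemma inversion_crossing:
  assumes "finite D" "D \<subseteq> {0<..} \<times> {0<..}" "a < b" "state D b 0 < state D a 0"
  shows "\<exists>r c. (Suc r, c) \<in> D \<and> state D r c = state D b 0 \<and> state D r (nxt D (Suc r) c) = state D a 0"
proof -
  \<comment> \<open>\<open>trace z k\<close> is the column reached by following the pipe that exits
    in row \<open>z\<close> upwards through \<open>k\<close> rows; \<open>pos z r\<close> is its
    column on the bottom of row \<open>r\<close>.\<close>
  define trace where "trace z k = rec_nat 0 (\<lambda>k c. hop D (z - k) c) k" for z k :: nat
  define pos where "pos z r = trace z (z - r)" for z r :: nat
  have pos_end: "pos z z = 0" for z
    by (simp add: pos_def trace_def)
  have pos_step: "pos z r = hop D (Suc r) (pos z (Suc r))" if "r < z" for z r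
  proof -
    have "z - r = Suc (z - Suc r)" "z - (z - Suc r) = Suc r" using that by auto
    then show ?thesis by (simp add: pos_def trace_def)
  qed
  have pos_state: "state D r (pos z r) = state D z 0" if "r \<le> z" for z r
    using that
  proof (induction rule: inc_induct)
    case (step r)
    then show ?case using pos_step[of r z] by simp
  qed (simp add: pos_end)
  have ne: "pos b r \<noteq> pos a r" if "r \<le> a" for r
    using pos_state[of r a] pos_state[of r b] that assms(3,4) by auto
  have ya: "0 < pos b a"
  proof (rule ccontr)
    assume "\<not> ?thesis"
    then have 0: "hop D (Suc a) (pos b (Suc a)) = 0" using pos_step[of a b] assms(3) by simp
    then have "pos b (Suc a) = 0" using hop_ge[OF assms(1)] by (metis le_zero_eq)
    then have "hop D (Suc a) (pos b (Suc a)) = nxt D (Suc a) 0"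
      using assms(2) by (auto simp: hop_def)
    with 0 nxt_props(1)[OF assms(1), of 0 "Suc a"] show False by simp
  qed
  define P where "P r \<longleftrightarrow> pos a r < pos b r" for r
  have Pa: "P a" using ya by (simp add: P_def pos_end)
  have nP0: "\<not> P 0" using pos_state[of 0 a] pos_state[of 0 b] assms(4) by (simp add: P_def)
  define m where "m = (LEAST r. P r)"
  have Pm: "P m" unfolding m_def using Pa by (rule LeastI)
  have ma: "m \<le> a" unfolding m_def using Pa by (rule Least_le)
  obtain r where r: "m = Suc r" using Pm nP0 by (cases m) auto
  have "\<not> P r" using not_less_Least[of r P] r by (simp add: m_def)
  have ra: "r < a" "r < b" using r ma assms(3) by auto
  define x where "x = pos a (Suc r)"
  define y where "y = pos b (Suc r)"
  have xy: "x < y" using Pm by (simp add: P_def r x_def y_def)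
  have hx: "pos a r = hop D (Suc r) x" and hy: "pos b r = hop D (Suc r) y"
    using pos_step ra by (simp_all add: x_def y_def)
  have lt: "hop D (Suc r) y < hop D (Suc r) x"
    using \<open>\<not> P r\<close> ne[of r] ra hx hy by (simp add: P_def)
  have "y \<le> hop D (Suc r) y" using hop_ge[OF assms(1)] .
  then have hopx: "hop D (Suc r) x = nxt D (Suc r) x" and yn: "y < nxt D (Suc r) x"
    using lt xy by (auto simp: hop_def split: if_splits)
  then have yD: "(Suc r, y) \<in> D" using nxt_props(3)[OF assms(1)] xy by blast
  then have hopy: "hop D (Suc r) y = y" by (simp add: hop_def)
  have "nxt D (Suc r) y = nxt D (Suc r) x"
    by (rule nxt_eqI) (use yn nxt_props[OF assms(1), where r="Suc r" and c=x] xy in auto)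
  then have "state D r y = state D b 0 \<and> state D r (nxt D (Suc r) y) = state D a 0"
    using pos_state[of r a] pos_state[of r b] ra hx hy hopx hopy by simp
  with yD show ?thesis by blast
qed

text \<open>Every inversion is realised by some cross, and there are only as many crosses as
  inversions, so every cross realises an inversion. This gives reducedness, and the bound
  \<open>n\<close> on the labels at a cross gives the staircase.\<close>

lemma RPD_subset_RP:
  assumes w: "w permutes {1..n}" and D: "D \<in> RPD w"
  shows "D \<in> RP n"
proof -
  have pd: "is_pipe_dream D" and fin: "finite D" and pos: "D \<subseteq> {0<..} \<times> {0<..}"
    using D by (auto simp: RPD_def is_pipe_dream_def)
  have wst: "w i = state D i 0" if "0 < i" for i
    using D has_permutation_iff[OF pd] that by (auto simp: RPD_def)
  define f where "f = (\<lambda>(r, c). (state D (r - 1) c, state D (r - 1) (nxt D r c)))"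
  define g where "g = (\<lambda>(a, b). (w b, w a))"
  have sub: "g ` inversions w \<subseteq> f ` D"
  proof (rule image_subsetI, clarify)
    fix a b assume ab: "(a, b) \<in> inversions w"
    then have "0 < a" "a < b" "w b < w a" by (auto simp: inversions_def)
    then obtain r c where rc: "(Suc r, c) \<in> D" "state D r c = w b"
      "state D r (nxt D (Suc r) c) = w a"
      using inversion_crossing[OF fin pos, of a b] wst[of a] wst[of b] by auto
    then have "g (a, b) = f (Suc r, c)" by (simp add: f_def g_def)
    then show "g (a, b) \<in> f ` D" using rc(1) by blast
  qed
  have "inj w" using w by (rule permutes_inj)
  then have "inj_on g (inversions w)" by (auto simp: inj_on_def g_def dest: injD)
  then have "card (g ` inversions w) = card (inversions w)" by (rule card_image)
  also have "\<dots> = card D" using D by (simp add: RPD_def)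
  finally have "card (f ` D) \<le> card (g ` inversions w)" using card_image_le[OF fin, of f] by simp
  then have eq: "g ` inversions w = f ` D"
    using sub fin by (intro card_seteq) auto
  have cross: "state D r c < state D r (nxt D (Suc r) c) \<and> state D r (nxt D (Suc r) c) \<le> n"
    if "(Suc r, c) \<in> D" for r c
  proof -
    have "f (Suc r, c) \<in> g ` inversions w" using that eq by blast
    then obtain a b where ab: "(a, b) \<in> inversions w" "state D r c = w b"
      "state D r (nxt D (Suc r) c) = w a"
      by (auto simp: f_def g_def)
    \<comment> \<open>If \<open>w a\<close> exceeds \<open>n\<close>, then \<open>w\<close> fixes
      \<open>a\<close> and every larger \<open>b\<close>, so \<open>(a, b)\<close> is no
      inversion.\<close>
    have "w a \<le> n"
    proof (rule ccontr)
      assume "\<not> w a \<le> n"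
      then have "a \<notin> {1..n}" using permutes_in_image[OF w, of a] by auto
      then have "w a = a" using w by (simp add: permutes_def)
      moreover have "b \<notin> {1..n}" using ab(1) \<open>a \<notin> {1..n}\<close> by (auto simp: inversions_def)
      then have "w b = b" using w by (simp add: permutes_def)
      ultimately show False using ab(1) by (auto simp: inversions_def)
    qed
    then show ?thesis using ab by (auto simp: inversions_def)
  qed
  have out: "(\<forall>c. n < r + c \<longrightarrow> state D r c = r + c \<and> (r, c) \<notin> D)" for r
  proof (induction r)
    case 0
    then show ?case using pos by auto
  next
    case (Suc r)
    have *: "(Suc r, c) \<notin> D" if "n < Suc r + c" for c
    proof
      assume a: "(Suc r, c) \<in> D"
      have "c < nxt D (Suc r) c" using nxt_props(1)[OF fin] .
      then have "state D r (nxt D (Suc r) c) > n" using Suc that by auto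
      then show False using cross[OF a] by simp
    qed
    have "state D (Suc r) c = Suc r + c" if "n < Suc r + c" for c
    proof -
      have "nxt D (Suc r) c = Suc c"
        by (rule nxt_eqI) (use *[of "Suc c"] that in auto)
      then show ?thesis using *[OF that] Suc that by (simp add: hop_def)
    qed
    with * show ?case by simp
  qed
  have "D \<subseteq> staircase n"
    using out pos by (force simp: staircase_def not_less[symmetric])
  then show ?thesis using cross by (simp add: RP_def reduced_def)
qed

lemma RP_finite: "D \<in> RP n \<Longrightarrow> finite D"
  using finite_subset finite_staircase by (auto simp: RP_def)

section \<open>Deleting the last pipe\<close>

text \<open>
  In \<open>insert_pipe a D\<close> the new pipe runs through row \<open>r\<close> from column \<open>a (r - 1)\<close> to column \<open>a r\<close>; the tiles
  of \<open>D\<close> to the right of it move down by one row. It exits in row \<open>m\<close>, and \<open>a r = 0\<close> for \<open>r \<ge> m\<close>.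
\<close>

definition pipe_path :: "nat \<Rightarrow> nat \<Rightarrow> pipe_dream \<Rightarrow> (nat \<Rightarrow> nat) \<Rightarrow> bool" where
  "pipe_path n m D a \<longleftrightarrow> a 0 = n \<and> (\<forall>r. 0 < a r \<longleftrightarrow> r < m) \<and> (\<forall>r<m. a (Suc r) < a r) \<and>
     (\<forall>r. (r, a r) \<notin> D)"

definition insert_pipe :: "(nat \<Rightarrow> nat) \<Rightarrow> pipe_dream \<Rightarrow> pipe_dream" where
  "insert_pipe a D = {(r, c). 0 < r \<and> 0 < c \<and> (c \<le> a r \<longrightarrow> (r, c) \<in> D) \<and>
     (a (r - 1) \<le> c \<longrightarrow> (r - 1, c) \<in> D)}"

lemma hop_bound:
  assumes "E \<subseteq> staircase k" "c + Suc r \<le> k"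
  shows "hop E (Suc r) c + r \<le> k"
proof (cases "(Suc r, c) \<in> E")
  case False
  have "nxt E (Suc r) c \<le> k - r"
    by (rule nxt_le) (use assms in \<open>auto simp: staircase_def\<close>)
  then show ?thesis using False assms(2) by (simp add: hop_def)
qed (use assms in \<open>simp add: hop_def\<close>)

lemma state_bound:
  assumes "E \<subseteq> staircase k"
  shows "c + r \<le> k \<Longrightarrow> state E r c \<le> k"
proof (induction r arbitrary: c)
  case (Suc r)
  then show ?case using hop_bound[OF assms, of c r] by simp
qed simp

locale inserted =
  fixes n m :: nat and D :: pipe_dream and a :: "nat \<Rightarrow> nat"
  assumes D: "D \<subseteq> staircase n" and path: "pipe_path (Suc n) m D a"
begin

lemma finD: "finite D"
  using finite_subset[OF D finite_staircase] .

lemma a0: "a 0 = Suc n" and a_pos: "0 < a r \<longleftrightarrow> r < m" and a_bump: "(r, a r) \<notin> D"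
  and a_dec: "r < m \<Longrightarrow> a (Suc r) < a r"
  using path by (auto simp: pipe_path_def)

lemma a_zero: "m \<le> r \<Longrightarrow> a r = 0"
  using a_pos[of r] by simp

lemma a_anti: "r \<le> s \<Longrightarrow> a s \<le> a r"
proof (rule lift_Suc_antimono_le[of a])
  show "a (Suc k) \<le> a k" for k
    using a_dec[of k] a_zero[of "Suc k"] by (cases "k < m") auto
qed

lemma a_strict: "r < s \<Longrightarrow> 0 < a r \<Longrightarrow> a s < a r"
  using a_dec[of r] a_pos[of r] a_anti[of "Suc r" s] by auto

lemma a_bound: "0 < a r \<Longrightarrow> a r + r \<le> Suc n"
proof (induction r)
  case (Suc r)
  then have "a (Suc r) < a r" "0 < a r" using a_dec[of r] a_pos[of r] a_pos[of "Suc r"] by auto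
  then show ?case using Suc by auto
qed (simp add: a0)

lemma m_pos: "0 < m"
  using a_pos[of 0] a0 by simp

lemma m_le: "m \<le> Suc n"
  using a_bound[of "m - 1"] a_pos[of "m - 1"] m_pos by auto

lemma D_pos: "(r, c) \<in> D \<Longrightarrow> 0 < r \<and> 0 < c \<and> r + c \<le> n"
  using D by (auto simp: staircase_def)

lemma insert_left: "c \<le> a (Suc r) \<Longrightarrow> (Suc r, c) \<in> insert_pipe a D \<longleftrightarrow> (Suc r, c) \<in> D"
  using a_strict[of r "Suc r"] a_pos[of r] a_pos[of "Suc r"] D_pos[of "Suc r" c]
  by (auto simp: insert_pipe_def)

lemma insert_right: "a r \<le> c \<Longrightarrow> (Suc r, c) \<in> insert_pipe a D \<longleftrightarrow> (r, c) \<in> D"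
  using a_strict[of r "Suc r"] a_zero[of r] a_zero[of "Suc r"] a_pos[of r] D_pos[of r c]
  by (auto simp: insert_pipe_def)

lemma insert_mid: "a (Suc r) < c \<Longrightarrow> c < a r \<Longrightarrow> (Suc r, c) \<in> insert_pipe a D"
  by (auto simp: insert_pipe_def)

lemma insert_staircase: "insert_pipe a D \<subseteq> staircase (Suc n)"
proof
  fix x assume x: "x \<in> insert_pipe a D"
  obtain r c where rc: "x = (Suc r, c)" "0 < c"
    using x by (cases x; cases "fst x") (auto simp: insert_pipe_def)
  consider "a r \<le> c" | "c < a r" by linarith
  then show "x \<in> staircase (Suc n)"
  proof cases
    case 1
    then show ?thesis using insert_right[OF 1] x rc D_pos[of r c] by (auto simp: staircase_def)
  next
    case 2
    then show ?thesis using a_bound[of r] rc by (auto simp: staircase_def)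
  qed
qed

lemma nxt_left:
  assumes "c < a (Suc r)"
  shows "nxt (insert_pipe a D) (Suc r) c = nxt D (Suc r) c" "nxt D (Suc r) c \<le> a (Suc r)"
proof -
  show "nxt (insert_pipe a D) (Suc r) c = nxt D (Suc r) c"
    by (rule nxt_cong_upto[where b = "a (Suc r)"]) (use assms insert_left finD a_bump in auto)
  show "nxt D (Suc r) c \<le> a (Suc r)"
    using assms nxt_le a_bump by blast
qed

lemma nxt_right: "a r \<le> c \<Longrightarrow> nxt (insert_pipe a D) (Suc r) c = nxt D r c"
  by (rule nxt_cong) (use insert_right in auto)

lemma nxt_mid: "a (Suc r) \<le> c \<Longrightarrow> c < a r \<Longrightarrow> nxt (insert_pipe a D) (Suc r) c = a r"
  by (rule nxt_eqI) (use insert_right[of r "a r"] insert_mid a_bump in auto)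

text \<open>Left of the new path nothing changes; right of it the tiles of \<open>D\<close> have
  moved down one row, hence \<open>r - 1\<close>. The test \<open>r \<le> m\<close> separates the
  exit of the new pipe in row \<open>m\<close> from column \<open>0\<close> of later rows, where
  also \<open>a r = 0\<close>.\<close>

lemma state_insert:
  "c + r \<le> Suc n \<Longrightarrow> state (insert_pipe a D) r c =
     (if c < a r then state D r c else if c = a r \<and> r \<le> m then Suc n else state D (r - 1) c)"
proof (induction r arbitrary: c)
  case 0
  then show ?case using a0 by auto
next
  case (Suc r)
  let ?X = "insert_pipe a D"
  have hb: "hop ?X (Suc r) c + r \<le> Suc n"
    using hop_bound[OF insert_staircase Suc.prems] .
  note IH = Suc.IH[OF hb]
  consider "c < a (Suc r)" | "c = a (Suc r)" "Suc r \<le> m" | "a (Suc r) < c" "c < a r"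
    | "a r \<le> c" "\<not> (c = a (Suc r) \<and> Suc r \<le> m)" "a (Suc r) \<le> c"
    using a_pos[of r] by atomize_elim auto
  then show ?case
  proof cases
    case 1
    have hop: "hop ?X (Suc r) c = hop D (Suc r) c"
      using nxt_left(1)[OF 1] insert_left[of c r] 1 by (simp add: hop_def)
    have "hop D (Suc r) c \<le> a (Suc r)"
      using nxt_left(2)[OF 1] 1 by (simp add: hop_def)
    also have "\<dots> < a r" using a_dec[of r] a_pos[of "Suc r"] 1 by simp
    finally show ?thesis using IH hop 1 by simp
  next
    case 2
    then have r: "r < m" "c < a r" using a_dec[of r] by auto
    have "(Suc r, c) \<notin> ?X" using insert_left[of c r] 2 a_bump by auto
    then have "hop ?X (Suc r) c = a r" using nxt_mid[of r c] 2 r by (simp add: hop_def)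
    then show ?thesis using IH 2 r by simp
  next
    case 3
    then have "hop ?X (Suc r) c = c" using insert_mid by (simp add: hop_def)
    then show ?thesis using IH 3 by auto
  next
    case 4
    have r0: "0 < r" using 4(1) a0 Suc.prems by (cases r) auto
    have hop: "hop ?X (Suc r) c = hop D r c"
      using nxt_right[OF 4(1)] insert_right[OF 4(1)] by (simp add: hop_def)
    \<comment> \<open>A pipe leaving row \<open>r\<close> of \<open>D\<close> at the bump
      \<open>(r, a r)\<close> entered that row strictly further right, so the induction hypothesis
      is applied right of the path.\<close>
    have "a r < hop D r c"
    proof (cases "c = a r")
      case True
      then show ?thesis using a_bump[of r] nxt_props(1)[OF finD, of c r] by (simp add: hop_def)
    next
      case False
      then show ?thesis using 4(1) hop_ge[OF finD, of c r] by simp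
    qed
    then have "state ?X (Suc r) c = state D (r - 1) (hop D r c)" using IH hop by simp
    also have "\<dots> = state D r c" using r0 by (cases r) auto
    finally show ?thesis using 4 by auto
  qed
qed

text \<open>Crosses off the path correspond to crosses of \<open>D\<close> with the same two pipes,
  and at the crosses on the path the horizontal pipe has the largest label
  \<open>Suc n\<close>.\<close>

lemma reduced_insert_iff: "reduced (insert_pipe a D) \<longleftrightarrow> reduced D"
proof -
  let ?X = "insert_pipe a D"
  have XS: "c + Suc r \<le> Suc n \<and> 0 < c" if "(Suc r, c) \<in> ?X" for r c
    using that insert_staircase by (auto simp: staircase_def)
  have bumpb: "nxt ?X (Suc r) c + r \<le> Suc n" if "(Suc r, c) \<in> ?X" for r c
  proof -
    have "nxt ?X (Suc r) c \<le> Suc n - r"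
      by (rule nxt_le) (use XS[OF that] insert_staircase in \<open>auto simp: staircase_def\<close>)
    then show ?thesis using XS[OF that] by linarith
  qed
  have left: "state ?X r c < state ?X r (nxt ?X (Suc r) c) \<longleftrightarrow> state D r c < state D r (nxt D (Suc r) c)"
    if "c < a (Suc r)" "(Suc r, c) \<in> ?X" for r c
  proof -
    have lt: "a (Suc r) < a r" using a_dec[of r] a_pos[of "Suc r"] that by simp
    have b: "c + r \<le> Suc n" "nxt D (Suc r) c + r \<le> Suc n"
      using XS[OF that(2)] bumpb[OF that(2)] nxt_left(1)[OF that(1)] by auto
    show ?thesis
      using state_insert[OF b(1)] state_insert[OF b(2)] lt that(1) nxt_left[OF that(1)] by auto
  qed
  have right: "state ?X (Suc r) c < state ?X (Suc r) (nxt ?X (Suc (Suc r)) c) \<longleftrightarrow>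
      state D r c < state D r (nxt D (Suc r) c)"
    if "a (Suc r) < c" "(Suc (Suc r), c) \<in> ?X" for r c
  proof -
    have gt: "a (Suc r) < nxt D (Suc r) c" using nxt_props(1)[OF finD, of c "Suc r"] that by simp
    have nx: "nxt ?X (Suc (Suc r)) c = nxt D (Suc r) c" using nxt_right that by simp
    have b: "c + Suc r \<le> Suc n" "nxt D (Suc r) c + Suc r \<le> Suc n"
      using XS[OF that(2)] bumpb[OF that(2)] nx by auto
    show ?thesis
      using state_insert[OF b(1)] state_insert[OF b(2)] that(1) gt nx by (auto simp del: state.simps)
  qed
  show ?thesis
  proof
    assume X: "reduced ?X"
    show "reduced D" unfolding reduced_def
    proof (intro allI impI)
      fix r c assume rc: "(Suc r, c) \<in> D"
      consider "c < a (Suc r)" | "a (Suc r) < c" using a_bump[of "Suc r"] rc by (metis nat_neq_iff)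
      then show "state D r c < state D r (nxt D (Suc r) c)"
      proof cases
        case 1
        then show ?thesis using left X insert_left[of c r] rc by (auto simp: reduced_def)
      next
        case 2
        then show ?thesis using right X insert_right[of "Suc r" c] rc
            by (auto simp: reduced_def simp del: state.simps)
      qed
    qed
  next
    assume R: "reduced D"
    show "reduced ?X" unfolding reduced_def
    proof (intro allI impI)
      fix r c assume rc: "(Suc r, c) \<in> ?X"
      consider "c \<le> a (Suc r)" | "a (Suc r) < c" "c < a r" | "a r \<le> c" by linarith
      then show "state ?X r c < state ?X r (nxt ?X (Suc r) c)"
      proof cases
        case 1
        then have "(Suc r, c) \<in> D" using insert_left rc by blast
        moreover from this have "c < a (Suc r)" using 1 a_bump[of "Suc r"] by (metis le_neq_implies_less)
        ultimately show ?thesis using left rc R by (auto simp: reduced_def)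
      next
        case 2
        then have r: "r < m" using a_pos[of r] by simp
        have "nxt ?X (Suc r) c = a r" using nxt_mid 2 by simp
        moreover have "state ?X r (a r) = Suc n"
          using state_insert[of "a r" r] a_bound[of r] 2 r by simp
        moreover have "c + r \<le> n" using 2 a_bound[of r] by simp
        then have "state ?X r c = state D r c" "state D r c \<le> n"
          using state_insert[of c r] 2 state_bound[OF D] by auto
        ultimately show ?thesis by simp
      next
        case 3
        then have D': "(r, c) \<in> D" using insert_right rc by blast
        then have "c \<noteq> a r" using a_bump by auto
        moreover obtain s where "r = Suc s" using D_pos[OF D'] gr0_implies_Suc by blast
        ultimately show ?thesis using right[of s c] rc R D' 3
          by (auto simp: reduced_def simp del: state.simps)
      qed
    qed
  qed
qed

lemma insert_RP: "D \<in> RP n \<Longrightarrow> insert_pipe a D \<in> RP (Suc n)"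
  using reduced_insert_iff insert_staircase by (auto simp: RP_def)

text \<open>The exits of the enlarged pipe dream determine the exit row \<open>m\<close> and the
  exits of \<open>D\<close>; this carries the hypothesis of equal permutations through the
  induction.\<close>

lemma exit_insert:
  assumes "r \<le> Suc n"
  shows "state (insert_pipe a D) r 0 =
    (if r < m then state D r 0 else if r = m then Suc n else state D (r - 1) 0)"
  using state_insert[of 0 r] assms a_pos[of r] a_zero[of r] by auto

end

section \<open>Paths over a fixed pipe dream; uniqueness and existence of the decomposition\<close>

lemma pipe_path_max:
  assumes "pipe_path n m D a" "pipe_path n m D b"
  shows "pipe_path n m D (\<lambda>r. max (a r) (b r))"
  unfolding pipe_path_def
proof (intro conjI allI impI)
  show "(r, max (a r) (b r)) \<notin> D" for r
    using assms by (cases "a r \<le> b r") (auto simp: pipe_path_def max_def)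
  show "max (a (Suc r)) (b (Suc r)) < max (a r) (b r)" if "r < m" for r
  proof -
    have "a (Suc r) < a r" "b (Suc r) < b r" using assms that by (auto simp: pipe_path_def)
    then show ?thesis by linarith
  qed
qed (use assms in \<open>auto simp: pipe_path_def\<close>)

lemma pipe_path_min:
  assumes "pipe_path n m D a" "pipe_path n m D b"
  shows "pipe_path n m D (\<lambda>r. min (a r) (b r))"
  unfolding pipe_path_def
proof (intro conjI allI impI)
  show "(r, min (a r) (b r)) \<notin> D" for r
    using assms by (cases "a r \<le> b r") (auto simp: pipe_path_def min_def)
  show "min (a (Suc r)) (b (Suc r)) < min (a r) (b r)" if "r < m" for r
  proof -
    have "a (Suc r) < a r" "b (Suc r) < b r" using assms that by (auto simp: pipe_path_def)
    then show ?thesis by linarith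
  qed
qed (use assms in \<open>auto simp: pipe_path_def\<close>)

text \<open>From a common start \<open>a r = b r\<close>, each path runs left through row
  \<open>Suc r\<close> over crosses up to a bump; if one went further than the other, a bump of one
  would be a cross of the other. Once the paths agree, the tiles on both sides give back
  \<open>D\<close>.\<close>

lemma insert_pipe_inject:
  assumes "D \<subseteq> staircase n" "E \<subseteq> staircase n" "pipe_path (Suc n) m D a" "pipe_path (Suc n) m' E b"
    and eq: "insert_pipe a D = insert_pipe b E"
  shows "D = E \<and> a = b"
proof -
  interpret A: inserted n m D a using assms by unfold_locales
  interpret B: inserted n m' E b using assms by unfold_locales
  have ab: "a r = b r" for r
  proof (induction r)
    case (Suc r)
    consider "a (Suc r) < b (Suc r)" | "b (Suc r) < a (Suc r)" | "a (Suc r) = b (Suc r)" by linarith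
    then show ?case
    proof cases
      case 1
      then have "b (Suc r) < a r" using Suc B.a_strict[of r "Suc r"] B.a_pos[of r] B.a_pos[of "Suc r"] by auto
      then have "(Suc r, b (Suc r)) \<in> insert_pipe a D" using A.insert_mid 1 by blast
      then show ?thesis using eq B.insert_left[of "b (Suc r)" r] B.a_bump by auto
    next
      case 2
      then have "a (Suc r) < b r" using Suc A.a_strict[of r "Suc r"] A.a_pos[of r] A.a_pos[of "Suc r"] by auto
      then have "(Suc r, a (Suc r)) \<in> insert_pipe b E" using B.insert_mid 2 by blast
      then show ?thesis using eq A.insert_left[of "a (Suc r)" r] A.a_bump by auto
    qed
  qed (simp add: A.a0 B.a0)
  have "(r, c) \<in> D \<longleftrightarrow> (r, c) \<in> E" for r c
  proof (cases "a r \<le> c")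
    case True
    then show ?thesis using A.insert_right B.insert_right ab eq by metis
  next
    case False
    then show ?thesis
    proof (cases r)
      case 0
      then show ?thesis using A.D_pos B.D_pos by blast
    next
      case (Suc s)
      then show ?thesis using A.insert_left[of c s] B.insert_left[of c s] ab eq False by auto
    qed
  qed
  then show ?thesis using ab by auto
qed

text \<open>By reducedness the pipe with the largest label \<open>Suc n\<close> is never vertical at
  a cross, so it turns left in every row that it enters and leaves that row at the next bump on its
  left.\<close>

lemma remove_pipe:
  assumes X: "X \<in> RP (Suc n)"
  obtains m D a where "D \<in> RP n" "pipe_path (Suc n) m D a" "X = insert_pipe a D"
proof -
  have XS: "X \<subseteq> staircase (Suc n)" and red: "reduced X" and fin: "finite X"
    using X RP_finite by (auto simp: RP_def)
  have X0: "(r, 0) \<notin> X" "(0, c) \<notin> X" for r c using XS by (auto simp: staircase_def)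
  define S where "S r x = {c. c < x \<and> (Suc r, c) \<notin> X}" for r x
  \<comment> \<open>Column \<open>0\<close> contains no cross, so \<open>S r x\<close> is nonempty
    for positive \<open>x\<close>; after reaching \<open>0\<close> the path stays there.\<close>
  define a where "a = rec_nat (Suc n) (\<lambda>r x. if x = 0 then 0 else Max (S r x))"
  have a0: "a 0 = Suc n" and aS: "a (Suc r) = (if a r = 0 then 0 else Max (S r (a r)))" for r
    by (simp_all add: a_def)
  have step: "a (Suc r) < a r \<and> (Suc r, a (Suc r)) \<notin> X \<and> (\<forall>c. a (Suc r) < c \<longrightarrow> c < a r \<longrightarrow> (Suc r, c) \<in> X)"
    if "0 < a r" for r
  proof -
    have "finite (S r (a r))" by (simp add: S_def)
    moreover have "0 \<in> S r (a r)" using that X0 by (simp add: S_def)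
    ultimately have "Max (S r (a r)) \<in> S r (a r)" "\<And>c. c \<in> S r (a r) \<Longrightarrow> c \<le> Max (S r (a r))"
      using Max_in by auto
    then show ?thesis using aS[of r] that by (auto simp: S_def not_le[symmetric])
  qed
  have bound: "0 < a r \<Longrightarrow> a r + r \<le> Suc n" for r
  proof (induction r)
    case (Suc r)
    then have "0 < a r" using aS[of r] by (auto split: if_splits)
    then show ?case using Suc step[of r] by simp
  qed (simp add: a0)
  define m where "m = (LEAST r. a r = 0)"
  have "a (Suc n) = 0" using bound[of "Suc n"] by auto
  then have am: "a m = 0" unfolding m_def by (rule LeastI)
  have zero: "a r = 0" if "m \<le> r" for r
    using that by (induction rule: dec_induct) (auto simp: am aS)
  have a_pos: "0 < a r \<longleftrightarrow> r < m" for r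
    using zero[of r] not_less_Least[of r "\<lambda>r. a r = 0"] unfolding m_def[symmetric]
    by (cases "r < m") auto
  have last: "state X r (a r) = Suc n \<and> (Suc r, a r) \<notin> X" if "r < m" for r
    using that
  proof (induction r)
    case 0
    then show ?case using XS by (auto simp: a0 staircase_def)
  next
    case (Suc r)
    then have pos: "0 < a r" "0 < a (Suc r)" using a_pos by auto
    have "nxt X (Suc r) (a (Suc r)) = a r"
      by (rule nxt_eqI) (use step[OF pos(1)] Suc in auto)
    then have st: "state X (Suc r) (a (Suc r)) = Suc n"
      using Suc step[OF pos(1)] by (simp add: hop_def)
    have "(Suc (Suc r), a (Suc r)) \<notin> X"
    proof
      assume cr: "(Suc (Suc r), a (Suc r)) \<in> X"
      then have "Suc n < state X (Suc r) (nxt X (Suc (Suc r)) (a (Suc r)))"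
        using red st by (force simp: reduced_def)
      moreover have "nxt X (Suc (Suc r)) (a (Suc r)) \<le> Suc n - Suc r"
        by (rule nxt_le) (use cr XS in \<open>auto simp: staircase_def\<close>)
      then have "nxt X (Suc (Suc r)) (a (Suc r)) + Suc r \<le> Suc n"
        using bound[OF pos(2)] by simp
      then have "state X (Suc r) (nxt X (Suc (Suc r)) (a (Suc r))) \<le> Suc n"
        by (rule state_bound[OF XS])
      ultimately show False by simp
    qed
    with st show ?case by simp
  qed
  \<comment> \<open>The tile \<open>(r, a r)\<close> becomes a bump of \<open>D\<close>; the tiles
    to its right come from the row below.\<close>
  define D where "D = {(r, c). 0 < r \<and> (c < a r \<and> (r, c) \<in> X \<or> a r < c \<and> (Suc r, c) \<in> X)}"
  have DS: "D \<subseteq> staircase n"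
  proof
    fix x assume "x \<in> D"
    then obtain r c where x: "x = (r, c)" "0 < r"
      "c < a r \<and> (r, c) \<in> X \<or> a r < c \<and> (Suc r, c) \<in> X" by (auto simp: D_def)
    then show "x \<in> staircase n"
      using bound[of r] XS X0(1)[of r] by (auto simp: staircase_def)
  qed
  have path: "pipe_path (Suc n) m D a"
    unfolding pipe_path_def using a0 a_pos step by (auto simp: D_def)
  interpret inserted n m D a using DS path by unfold_locales
  have "X = insert_pipe a D"
  proof -
    have "(Suc r, c) \<in> X \<longleftrightarrow> (Suc r, c) \<in> insert_pipe a D" for r c
    proof -
      consider "c < a (Suc r)" | "c = a (Suc r)" "r < m" | "a (Suc r) < c" "c < a r" | "a r < c" | "c = a r"
        using a_pos[of r] a_zero[of "Suc r"] a_anti[of r "Suc r"] by linarith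
      then show ?thesis
      proof cases
        case 1
        then show ?thesis using insert_left[of c r] by (auto simp: D_def)
      next
        case 2
        then show ?thesis using insert_left[of c r] step[of r] a_pos[of r] a_bump by auto
      next
        case 3
        then show ?thesis using insert_mid step[of r] by auto
      next
        case 4
        then show ?thesis using insert_right[of r c] XS a0
          by (cases "r = 0") (auto simp: D_def staircase_def)
      next
        case 5
        have "(Suc r, a r) \<notin> X" using last[of r] zero[of r] X0 by (cases "r < m") auto
        then show ?thesis using 5 insert_right[of r c] a_bump by auto
      qed
    qed
    moreover have "(0, c) \<in> X \<longleftrightarrow> (0, c) \<in> insert_pipe a D" for c
      using X0 by (auto simp: insert_pipe_def)
    ultimately have "(r, c) \<in> X \<longleftrightarrow> (r, c) \<in> insert_pipe a D" for r c
      by (cases r) auto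
    then show ?thesis by auto
  qed
  moreover from this have "D \<in> RP n" using red reduced_insert_iff DS by (auto simp: RP_def)
  ultimately show ?thesis using that path by blast
qed

section \<open>The order of the pipes under a ladder move\<close>

definition ladder :: "nat \<Rightarrow> nat \<Rightarrow> nat \<Rightarrow> nat \<Rightarrow> pipe_dream \<Rightarrow> pipe_dream" where
  "ladder h i j k D = insert (h, k) (D - {(i, j)})"

text \<open>The move without reference to \<open>w\<close>; \<open>RPD_steps_iff\<close> shows that
  membership in \<open>RPD w\<close> is preserved.\<close>

definition ladder_step :: "pipe_dream \<Rightarrow> pipe_dream \<Rightarrow> bool" where
  "ladder_step D E \<longleftrightarrow> (\<exists>h i j k. ladder_rectangle D h i j k \<and> E = ladder h i j k D)"

locale rectangle =
  fixes D :: pipe_dream and h i j k :: nat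
  assumes finD: "finite D" and rect: "ladder_rectangle D h i j k"
begin

lemma pos: "0 < h" "h < i" "0 < j" "j < k"
  and corners: "(i, j) \<in> D" "(h, j) \<notin> D" "(i, k) \<notin> D" "(h, k) \<notin> D"
  using rect by (auto simp: ladder_rectangle_def)

lemma full: "h \<le> r \<Longrightarrow> r \<le> i \<Longrightarrow> j \<le> c \<Longrightarrow> c \<le> k \<Longrightarrow> (r, c) \<noteq> (h, j) \<Longrightarrow> (r, c) \<noteq> (i, k) \<Longrightarrow>
    (r, c) \<noteq> (h, k) \<Longrightarrow> (r, c) \<in> D"
  using rect by (auto simp: ladder_rectangle_def)

lemma nxt_top: "j \<le> c \<Longrightarrow> c < k \<Longrightarrow> nxt D h c = k"
  by (rule nxt_eqI) (use pos corners in \<open>auto intro: full\<close>)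

lemma nxt_bottom: "j \<le> c \<Longrightarrow> c < k \<Longrightarrow> nxt D i c = k"
  by (rule nxt_eqI) (use pos corners in \<open>auto intro: full\<close>)

abbreviation "E \<equiv> ladder h i j k D"

abbreviation "\<tau> \<equiv> transpose j k"

lemma mem_E: "(r, c) \<in> E \<longleftrightarrow> (r, c) = (h, k) \<or> (r, c) \<in> D \<and> (r, c) \<noteq> (i, j)"
  by (auto simp: ladder_def)

lemma finE: "finite E"
  using finD by (simp add: ladder_def)

lemma hop_other: "r \<noteq> h \<Longrightarrow> r \<noteq> i \<Longrightarrow> hop E r c = hop D r c"
proof -
  assume r: "r \<noteq> h" "r \<noteq> i"
  have "nxt E r c = nxt D r c" by (rule nxt_cong) (use r in \<open>auto simp: mem_E\<close>)
  then show ?thesis using r by (simp add: hop_def mem_E)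
qed

lemma nxt_eq_outside:
  assumes "r = h \<or> r = i" "k \<le> c"
  shows "nxt E r c = nxt D r c"
  by (rule nxt_cong) (use assms pos in \<open>auto simp: mem_E\<close>)

text \<open>Turning the bump \<open>(h, k)\<close> into a cross exchanges the two pipes that leave
  row \<open>h\<close> in columns \<open>j\<close> and \<open>k\<close>.\<close>

lemma hop_top: "hop E h c = hop D h (\<tau> c)"
proof -
  consider "c < j" | "c = j" | "j < c" "c < k" | "c = k" | "k < c" by linarith
  then show ?thesis
  proof cases
    case 1
    have "nxt D h c = nxt E h c"
      by (rule nxt_cong_upto[where b = j]) (use 1 pos corners finE in \<open>auto simp: mem_E\<close>)
    then show ?thesis using 1 pos by (auto simp: hop_def mem_E transpose_def)
  next
    case 2
    have "nxt E h j = nxt D h k"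
    proof (rule nxt_eqI)
      show "j < nxt D h k" using nxt_props(1)[OF finD, of k h] pos by simp
      show "(h, nxt D h k) \<notin> E"
        using nxt_props(1)[OF finD, of k h] nxt_props(2)[OF finD, of h k] pos by (auto simp: mem_E)
      show "(h, y) \<in> E" if "j < y" "y < nxt D h k" for y
        using that nxt_props(3)[OF finD, of k y h] full[of h y] pos
        by (cases y k rule: linorder_cases) (auto simp: mem_E)
    qed
    then show ?thesis using 2 pos corners by (auto simp: hop_def mem_E)
  next
    case 3
    then show ?thesis using full[of h c] pos by (auto simp: hop_def mem_E transpose_def)
  next
    case 4
    then show ?thesis using corners nxt_top[of j] pos by (auto simp: hop_def mem_E)
  next
    case 5
    then show ?thesis using nxt_eq_outside[of h c] pos by (auto simp: hop_def mem_E transpose_def)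
  qed
qed

text \<open>In rows strictly between \<open>h\<close> and \<open>i\<close>, the columns
  \<open>j\<close> and \<open>k\<close> are passed vertically, so the exchange commutes with these
  rows.\<close>

lemma hop_middle:
  assumes "h < r" "r < i"
  shows "\<tau> (hop D r c) = hop D r (\<tau> c)"
proof -
  have jk: "hop D r j = j" "hop D r k = k" using full assms pos by (auto simp: hop_def)
  then have "hop D r c \<noteq> j" "hop D r c \<noteq> k" if "c \<noteq> j" "c \<noteq> k"
    using hop_inj[OF finD, of r c j] hop_inj[OF finD, of r c k] that by auto
  with jk show ?thesis by (auto simp: transpose_def)
qed

text \<open>Turning the cross \<open>(i, j)\<close> into a bump exchanges columns \<open>j\<close>
  and \<open>k\<close> a second time, on the upper side of row \<open>i\<close>, which cancels the
  exchange made in row \<open>h\<close>.\<close>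

lemma hop_bottom: "\<tau> (hop E i c) = hop D i c"
proof -
  consider "c < j" "(i, c) \<in> D" | "c < j" "(i, c) \<notin> D" "nxt D i c < j"
    | "c < j" "(i, c) \<notin> D" "j \<le> nxt D i c" | "c = j" | "j < c" "c < k" | "k \<le> c" by linarith
  then show ?thesis
  proof cases
    case 1
    then show ?thesis using pos by (auto simp: hop_def mem_E transpose_def)
  next
    case 2
    have "nxt E i c = nxt D i c"
      by (rule nxt_cong_upto[where b = "nxt D i c"])
        (use 2 pos finD nxt_props[OF finD] in \<open>auto simp: mem_E\<close>)
    then show ?thesis using 2 pos by (auto simp: hop_def mem_E transpose_def)
  next
    case 3
    have "nxt D i c = k"
    proof (rule nxt_eqI)
      show "(i, y) \<in> D" if "c < y" "y < k" for y
        using that 3 nxt_props(3)[OF finD, of c y i] full[of i y] pos by (cases "y < j") auto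
    qed (use 3 pos corners in auto)
    moreover have "nxt E i c = j"
      by (rule nxt_eqI) (use 3 pos nxt_props(3)[OF finD, where r = i and c = c] in \<open>auto simp: mem_E\<close>)
    ultimately show ?thesis using 3 pos by (auto simp: hop_def mem_E)
  next
    case 4
    have "nxt E i j = nxt D i j"
      by (rule nxt_cong) (use pos in \<open>auto simp: mem_E\<close>)
    then show ?thesis using 4 pos corners nxt_bottom[of j] by (auto simp: hop_def mem_E)
  next
    case 5
    then show ?thesis using full[of i c] pos by (auto simp: hop_def mem_E transpose_def)
  next
    case 6
    have "k \<noteq> hop D i c" using nxt_props(1)[OF finD, of c i] corners 6 by (auto simp: hop_def)
    moreover have "k \<le> hop D i c" using hop_ge[OF finD, of c i] 6 by simp
    moreover have "hop E i c = hop D i c"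
      using nxt_eq_outside[of i c] 6 pos by (auto simp: hop_def mem_E)
    ultimately show ?thesis using pos by (auto simp: transpose_def)
  qed
qed

lemma state_ladder:
  "state E r c = state D r (if h \<le> r \<and> r < i then \<tau> c else c)"
proof (induction r arbitrary: c)
  case 0
  then show ?case using pos by simp
next
  case (Suc r)
  consider "Suc r < h" | "Suc r = h" | "h < Suc r" "Suc r < i" | "Suc r = i" | "i < Suc r" by linarith
  then show ?case
  proof cases
    case 1
    then show ?thesis using Suc hop_other[of "Suc r"] pos by simp
  next
    case 2
    have "state E (Suc r) c = state D (Suc r) (\<tau> c)"
      using Suc.IH hop_top[of c] unfolding 2[symmetric] by simp
    then show ?thesis using 2 pos by simp
  next
    case 3
    then show ?thesis using Suc hop_other[of "Suc r"] hop_middle[of "Suc r"] pos by simp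
  next
    case 4
    have "state E (Suc r) c = state D (Suc r) c"
      using Suc.IH hop_bottom[of c] pos unfolding 4[symmetric] by simp
    then show ?thesis using 4 pos by simp
  next
    case 5
    then show ?thesis using Suc hop_other[of "Suc r"] pos by simp
  qed
qed

lemma state_column_const:
  assumes "h \<le> r" "r < i" "j \<le> c" "c \<le> k"
  shows "state D r c = state D h c"
  using assms
proof (induction rule: dec_induct)
  case (step r)
  then show ?case using full[of "Suc r" c] by (simp add: hop_def)
qed simp

end

locale reduced_rectangle = rectangle +
  assumes red: "reduced D"
begin

text \<open>Reducedness at the cross \<open>(i, j)\<close>: its horizontal pipe turned at the bump
  \<open>(i, k)\<close>, and both pipes run vertically down from row \<open>h\<close>.\<close>

lemma state_corner_less:
  assumes "h \<le> r" "r < i"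
  shows "state D r j < state D r k"
proof -
  obtain i' where i': "i = Suc i'" "h \<le> i'" using pos by (cases i) auto
  have "state D i' j < state D i' (nxt D i j)"
    using red corners i' by (auto simp: reduced_def)
  then show ?thesis
    using nxt_bottom[of j] pos state_column_const[of i' j] state_column_const[of i' k] i'
      state_column_const[of r j] state_column_const[of r k] assms by simp
qed

text \<open>Reducedness at the cross \<open>(h, c)\<close>: its horizontal pipe is the one that
  turns down at the bump \<open>(h, j)\<close>.\<close>

lemma state_middle_less:
  assumes "h \<le> r" "r < i" "j < c" "c < k"
  shows "state D r c < state D r j"
proof -
  obtain h' where h': "h = Suc h'" using pos by (cases h) auto
  have hc: "(h, c) \<in> D" using full assms pos by auto
  then have "state D h' c < state D h' (nxt D h c)"
    using red h' by (auto simp: reduced_def)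
  then have "state D h c < state D h j"
    using nxt_top[of c] nxt_top[of j] assms pos corners hc h' by (simp add: hop_def)
  then show ?thesis
    using state_column_const[of r c] state_column_const[of r j] assms pos by simp
qed

end

section \<open>Lehmer codes of the pipe order\<close>

definition lehmer :: "pipe_dream \<Rightarrow> nat \<Rightarrow> nat \<Rightarrow> nat" where
  "lehmer D r c = card {x. 0 < x \<and> x < c \<and> state D r c < state D r x}"

text \<open>Entries are compared pipe by pipe rather than column by column: \<open>c'\<close> is the
  column in which \<open>E\<close> has the pipe that \<open>D\<close> has in column
  \<open>c\<close>.\<close>

definition lehmer_le :: "pipe_dream \<Rightarrow> pipe_dream \<Rightarrow> nat \<Rightarrow> bool" where
  "lehmer_le D E r \<longleftrightarrow>
     (\<forall>c>0. \<exists>c'>0. state E r c' = state D r c \<and> lehmer D r c \<le> lehmer E r c')"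

lemma lehmer_le_refl: "lehmer_le D D r"
  by (auto simp: lehmer_le_def)

lemma lehmer_le_trans: "lehmer_le D E r \<Longrightarrow> lehmer_le E F r \<Longrightarrow> lehmer_le D F r"
  unfolding lehmer_le_def by (metis order_trans)

context reduced_rectangle
begin

text \<open>In rows \<open>h\<close> to \<open>i - 1\<close> the larger of two pipes moves from
  column \<open>k\<close> to column \<open>j\<close>, and all pipes between are smaller than both.
  The larger mover passes only smaller pipes, the smaller one gains a larger pipe on its left, and
  each pipe between still has one of the two on its left.\<close>

lemma lehmer_le_ladder: "lehmer_le D E r"
proof (cases "h \<le> r \<and> r < i")
  case False
  have "state E r = state D r"
    by (rule ext) (use state_ladder[of r] False in auto)
  then show ?thesis by (auto simp: lehmer_le_def lehmer_def)
next
  case True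
  then have E: "state E r c = state D r (\<tau> c)" for c
    using state_ladder[of r] by simp
  have jk: "state D r j < state D r k" using state_corner_less True by simp
  have mid: "state D r c < state D r j" if "j < c" "c < k" for c
    using state_middle_less True that by simp
  show ?thesis unfolding lehmer_le_def
  proof (intro allI impI)
    fix c :: nat assume c: "0 < c"
    define S where "S = {x. 0 < x \<and> x < c \<and> state D r c < state D r x}"
    \<comment> \<open>\<open>S'\<close> is the set counted for the same pipe after the move, where
      it sits in column \<open>\<tau> c\<close>.\<close>
    define S' where "S' = {x. 0 < x \<and> x < \<tau> c \<and> state D r c < state D r (\<tau> x)}"
    have fin: "finite S'" by (simp add: S'_def)
    have "\<exists>f. inj_on f S \<and> f ` S \<subseteq> S'"
    proof -
      consider "c < j" | "c = j" | "j < c" "c < k" | "c = k" | "k < c" by linarith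
      then show ?thesis
      proof cases
        case 1
        then have "id ` S \<subseteq> S'" using pos by (auto simp: S_def S'_def transpose_def)
        then show ?thesis by (metis inj_on_id)
      next
        case 2
        then have "id ` S \<subseteq> S'" using pos by (auto simp: S_def S'_def transpose_def)
        then show ?thesis by (metis inj_on_id)
      next
        case 3
        then have "id ` S \<subseteq> S'" using pos jk mid[of c] by (auto simp: S_def S'_def transpose_def)
        then show ?thesis by (metis inj_on_id)
      next
        case 4
        have "x < j" if "x < k" "state D r k < state D r x" for x
          using that mid[of x] jk by (cases x j rule: linorder_cases) auto
        then have "id ` S \<subseteq> S'" using pos 4 by (auto simp: S_def S'_def transpose_def)
        then show ?thesis by (metis inj_on_id)
      next
        case 5
        then have "\<tau> ` S \<subseteq> S'" using pos by (auto simp: S_def S'_def transpose_def)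
        moreover have "inj_on \<tau> S" by simp
        ultimately show ?thesis by blast
      qed
    qed
    then have "card S \<le> card S'" using fin card_inj_on_le by blast
    moreover have "0 < \<tau> c" using c pos by (auto simp: transpose_def)
    moreover have "state E r (\<tau> c) = state D r c" using E by simp
    ultimately show "\<exists>c'>0. state E r c' = state D r c \<and> lehmer D r c \<le> lehmer E r c'"
      using E by (intro exI[of _ "\<tau> c"]) (auto simp: lehmer_def S_def S'_def)
  qed
qed

end

section \<open>Sets of pipes to the west\<close>

definition west :: "pipe_dream \<Rightarrow> nat \<Rightarrow> nat \<Rightarrow> nat set" where
  "west D r x = state D r ` {0<..<x}"

lemma west_mono: "x \<le> y \<Longrightarrow> west D r x \<subseteq> west D r y"
  by (auto simp: west_def)

text \<open>Within one pipe dream the pipes in a row are distinct, so these sets grow strictly with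
  the column. Positivity of \<open>y\<close> excludes \<open>y = 0\<close>, \<open>x = 1\<close>,
  where both sets are empty.\<close>

lemma west_subset_iff:
  assumes "finite D" "0 < y"
  shows "west D r x \<subseteq> west D r y \<longleftrightarrow> x \<le> y"
proof
  assume *: "west D r x \<subseteq> west D r y"
  show "x \<le> y"
  proof (rule ccontr)
    assume "\<not> x \<le> y"
    then have "state D r y \<in> west D r y" using * assms(2) by (force simp: west_def)
    then show False using state_inj[OF assms(1)] by (force simp: west_def)
  qed
qed (rule west_mono)

text \<open>In the affected rows, neither or both of the columns \<open>j\<close> and
  \<open>k\<close> lie west of \<open>x\<close>, so the transposition permutes the columns
  counted.\<close>

lemma (in rectangle) west_ladder:
  assumes "h \<le> r \<Longrightarrow> r < i \<Longrightarrow> x \<le> j \<or> k < x"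
  shows "west E r x = west D r x"
proof (cases "h \<le> r \<and> r < i")
  case False
  then have "state E r = state D r" by (intro ext) (auto simp: state_ladder)
  then show ?thesis by (simp add: west_def)
next
  case True
  then have st: "state E r c = state D r (\<tau> c)" for c using state_ladder by simp
  have "\<tau> ` {0<..<x} = {0<..<x}"
    by (rule transpose_image_eq) (use assms True pos in auto)
  then have "state D r ` \<tau> ` {0<..<x} = state D r ` {0<..<x}" by simp
  then show ?thesis by (simp add: west_def st image_image)
qed

context reduced_rectangle
begin

text \<open>
  The largest pipe \<open>y\<close> of \<open>west F h x\<close> outside \<open>west D h j\<close> would have, among the pipes to its left
  in \<open>F\<close>, only pipes of \<open>west D h j\<close> exceeding it, whereas in \<open>E\<close> the pipe in column \<open>j\<close> exceeds it
  too; its Lehmer code would have dropped.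
\<close>

lemma west_blocked:
  assumes F: "finite F" "lehmer_le E F h" and sub: "west F h x \<subseteq> west D h k"
  shows "west F h x \<subseteq> west D h j"
proof (rule ccontr)
  assume ns: "\<not> west F h x \<subseteq> west D h j"
  define M where "M = west F h x - west D h j"
  have "finite M" "M \<noteq> {}" using ns by (auto simp: M_def west_def)
  define y where "y = Max M"
  have yM: "y \<in> M" and ymax: "\<And>z. z \<in> M \<Longrightarrow> z \<le> y"
    using \<open>finite M\<close> \<open>M \<noteq> {}\<close> by (auto simp: y_def)
  obtain c0 where c0: "0 < c0" "c0 < x" "y = state F h c0"
    using yM by (auto simp: M_def west_def)
  have "y \<in> west D h k" using yM sub by (auto simp: M_def)
  then obtain c1 where c1: "0 < c1" "c1 < k" "y = state D h c1"
    by (auto simp: west_def)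
  have "j \<le> c1" using yM c1 by (force simp: M_def west_def not_less[symmetric])
  \<comment> \<open>\<open>c2\<close> is the column of \<open>y\<close> in \<open>E\<close>; it lies
    right of \<open>j\<close> because a pipe in column \<open>j\<close> of \<open>D\<close> has
    moved to column \<open>k\<close>.\<close>
  define c2 where "c2 = \<tau> c1"
  have c2: "j < c2" "state E h c2 = y"
    using \<open>j \<le> c1\<close> c1 pos state_ladder[of h c2] by (auto simp: c2_def transpose_def)
  obtain c' where c': "state F h c' = y" "lehmer E h c2 \<le> lehmer F h c'"
    using F(2) c2 unfolding lehmer_le_def by (metis gr_implies_not0 gr0I)
  then have "c' = c0" using state_inj[OF F(1)] c0 by metis
  \<comment> \<open>By maximality of \<open>y\<close>, the larger pipes left of \<open>y\<close> in
    \<open>F\<close> lie in \<open>A\<close>; in \<open>E\<close> all of \<open>A\<close> is left of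
    \<open>y\<close>, and so is the pipe \<open>state D h k\<close>, now in column
    \<open>j\<close>.\<close>
  define A where "A = {z \<in> west D h j. y < z}"
  have finA: "finite A" by (simp add: A_def west_def)
  have "lehmer F h c0 = card (state F h ` {z. 0 < z \<and> z < c0 \<and> y < state F h z})"
    unfolding lehmer_def c0(3)[symmetric]
    by (rule card_image[symmetric]) (auto intro!: inj_onI dest: state_inj[OF F(1)])
  also have "\<dots> \<le> card A"
  proof (rule card_mono[OF finA], rule image_subsetI)
    fix z assume "z \<in> {z. 0 < z \<and> z < c0 \<and> y < state F h z}"
    then have z: "0 < z" "z < c0" "y < state F h z" by simp_all
    then have "state F h z \<in> west F h x" using c0(2) unfolding west_def by simp
    moreover have "state F h z \<notin> M" using ymax[of "state F h z"] z(3) by linarith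
    ultimately show "state F h z \<in> A" using z(3) unfolding M_def A_def by blast
  qed
  finally have 1: "lehmer F h c0 \<le> card A" .
  have Ej: "state E h j = state D h k" using state_ladder[of h j] pos by simp
  have qy: "y < state D h k"
    using c1 \<open>j \<le> c1\<close> state_corner_less[of h] state_middle_less[of h c1] pos
    by (cases "c1 = j") auto
  have "state D h k \<notin> A" using state_inj[OF finD, of h k] pos by (auto simp: A_def west_def)
  then have "Suc (card A) = card (insert (state D h k) A)" using finA by simp
  also have "\<dots> \<le> card (state E h ` {z. 0 < z \<and> z < c2 \<and> y < state E h z})"
  proof (rule card_mono)
    show "insert (state D h k) A \<subseteq> state E h ` {z. 0 < z \<and> z < c2 \<and> y < state E h z}"
    proof
      fix z assume "z \<in> insert (state D h k) A"
      then consider "z = state D h k" | c where "0 < c" "c < j" "z = state D h c" "y < z"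
        by (auto simp: A_def west_def)
      then show "z \<in> state E h ` {z. 0 < z \<and> z < c2 \<and> y < state E h z}"
      proof cases
        case 1
        then show ?thesis using Ej c2 qy pos by (intro image_eqI[of _ _ j]) auto
      next
        case 2
        then show ?thesis using state_ladder[of h c] c2 pos
          by (intro image_eqI[of _ _ c]) (auto simp: transpose_def)
      qed
    qed
  qed simp
  also have "\<dots> = lehmer E h c2"
    unfolding lehmer_def c2(2)
    by (rule card_image) (auto intro!: inj_onI dest: state_inj[OF finE])
  finally show False using 1 c' \<open>c' = c0\<close> by simp
qed

end

section \<open>Ladder moves and the last pipe\<close>

context inserted
begin

text \<open>Stated for arbitrary \<open>X\<close> because \<open>insert_ladder\<close> applies it
  also to the pipe dream after the move.\<close>

lemma mem_insert_cases:
  assumes "0 < c"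
  shows "c \<le> a (Suc r) \<Longrightarrow> (Suc r, c) \<in> insert_pipe a X \<longleftrightarrow> (Suc r, c) \<in> X"
    and "a r \<le> c \<Longrightarrow> (Suc r, c) \<in> insert_pipe a X \<longleftrightarrow> (r, c) \<in> X"
    and "a (Suc r) < c \<Longrightarrow> c < a r \<Longrightarrow> (Suc r, c) \<in> insert_pipe a X"
proof -
  have "a (Suc r) < a r \<or> a (Suc r) = 0"
    using a_dec[of r] a_zero[of "Suc r"] by (cases "r < m") auto
  then show "c \<le> a (Suc r) \<Longrightarrow> (Suc r, c) \<in> insert_pipe a X \<longleftrightarrow> (Suc r, c) \<in> X"
    and "a r \<le> c \<Longrightarrow> (Suc r, c) \<in> insert_pipe a X \<longleftrightarrow> (r, c) \<in> X"
    using assms by (auto simp: insert_pipe_def)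
qed (simp add: insert_pipe_def assms)

text \<open>The row of \<open>insert_pipe a D\<close> that receives the tile \<open>(h, k)\<close>
  of \<open>D\<close> when this tile is off the path.\<close>

abbreviation row_image :: "nat \<Rightarrow> nat \<Rightarrow> nat" where
  "row_image h k \<equiv> if k < a h then h else Suc h"

lemma row_image_cases:
  assumes "a h \<noteq> k" "0 < k"
  shows "k \<le> a (Suc s) \<Longrightarrow> row_image h k = Suc s \<longleftrightarrow> h = Suc s"
    and "a s \<le> k \<Longrightarrow> row_image h k = Suc s \<longleftrightarrow> h = s"
    and "a (Suc s) < k \<Longrightarrow> k < a s \<Longrightarrow> row_image h k \<noteq> Suc s"
proof -
  have as: "a (Suc s) \<le> a s" using a_anti by simp
  have ms: "k < a s" if "k \<le> a (Suc s)"
    using a_strict[of s "Suc s"] a_pos[of s] a_pos[of "Suc s"] that assms(2) by auto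
  show "k \<le> a (Suc s) \<Longrightarrow> row_image h k = Suc s \<longleftrightarrow> h = Suc s"
    using ms assms by (cases "h = Suc s") auto
  show "a s \<le> k \<Longrightarrow> row_image h k = Suc s \<longleftrightarrow> h = s"
    using as assms by (cases "h = s") auto
  show "a (Suc s) < k \<Longrightarrow> k < a s \<Longrightarrow> row_image h k \<noteq> Suc s"
    by auto
qed

lemma insert_ladder:
  assumes "a h \<noteq> k" "a i \<noteq> j" "0 < h" "0 < j" "0 < k"
  shows "insert_pipe a (ladder h i j k D) =
    ladder (row_image h k) (row_image i j) j k (insert_pipe a D)" (is "?L = ladder ?H ?I j k ?X")
proof -
  have L: "(r, c) \<in> ladder h i j k Y \<longleftrightarrow> r = h \<and> c = k \<or> (r, c) \<in> Y \<and> \<not> (r = i \<and> c = j)" for r c h i Y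
    by (auto simp: ladder_def)
  have "(r, c) \<in> ?L \<longleftrightarrow> (r, c) \<in> ladder ?H ?I j k ?X" for r c
  proof (cases "0 < r \<and> 0 < c")
    case False
    have "0 < ?H" using assms by simp
    then have "r \<noteq> ?H \<or> c \<noteq> k" using False assms by auto
    moreover have "(r, c) \<notin> ?L" "(r, c) \<notin> ?X" using False by (auto simp: insert_pipe_def)
    ultimately show ?thesis unfolding L by blast
  next
    case True
    then obtain s where s: "r = Suc s" "0 < c" by (cases r) auto
    consider "c \<le> a (Suc s)" | "a (Suc s) < c" "c < a s" | "a s \<le> c" by linarith
    then show ?thesis
    proof cases
      case 1
      have "Suc s = ?H \<and> c = k \<longleftrightarrow> Suc s = h \<and> c = k" "Suc s = ?I \<and> c = j \<longleftrightarrow> Suc s = i \<and> c = j"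
        using row_image_cases(1)[OF assms(1,5), of s] row_image_cases(1)[OF assms(2,4), of s] 1
        by metis+
      then show ?thesis unfolding L s(1) mem_insert_cases(1)[OF s(2) 1] by blast
    next
      case 2
      then have "\<not> (Suc s = ?I \<and> c = j)"
        using row_image_cases(3)[OF assms(2,4), of s] by metis
      then show ?thesis using mem_insert_cases(3)[OF s(2) 2] unfolding L s(1) by blast
    next
      case 3
      have "Suc s = ?H \<and> c = k \<longleftrightarrow> s = h \<and> c = k" "Suc s = ?I \<and> c = j \<longleftrightarrow> s = i \<and> c = j"
        using row_image_cases(2)[OF assms(1,5), of s] row_image_cases(2)[OF assms(2,4), of s] 3
        by metis+
      then show ?thesis unfolding L s(1) mem_insert_cases(2)[OF s(2) 3] by blast
    qed
  qed
  then show ?thesis by auto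
qed

lemma pipe_path_ladder:
  assumes "a h \<noteq> k"
  shows "pipe_path (Suc n) m (ladder h i j k D) a"
  using path assms by (auto simp: pipe_path_def ladder_def)

text \<open>The path visits only bumps, and in rows \<open>h\<close> to \<open>i - 1\<close> the
  only bump in columns \<open>j + 1\<close> to \<open>k\<close> is \<open>(h, k)\<close>.\<close>

lemma path_outside_rectangle:
  assumes "ladder_rectangle D h i j k" "a h \<noteq> k" "h \<le> r" "r < i"
  shows "a r \<le> j \<or> k < a r"
proof (rule ccontr)
  assume "\<not> ?thesis"
  then have "(r, a r) \<in> D" using assms by (cases "r = h") (auto simp: ladder_rectangle_def)
  then show False using a_bump by simp
qed

lemma path_corner_less:
  assumes "ladder_rectangle D h i j k" "a i < k"
  shows "a i < j"
proof (rule ccontr)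
  assume "\<not> ?thesis"
  then have "(i, a i) \<in> D" using assms by (auto simp: ladder_rectangle_def)
  then show False using a_bump by simp
qed

text \<open>The path passes the rectangle on its right, on its left, or runs through it within a
  single row. Accordingly the rectangle stays, moves down by one row, or is stretched by one row of
  crosses.\<close>

lemma lift_ladder:
  assumes R: "ladder_rectangle D h i j k" and ak: "a h \<noteq> k"
  shows "ladder_step (insert_pipe a D) (insert_pipe a (ladder h i j k D))"
proof -
  let ?X = "insert_pipe a D"
  have pos: "0 < h" "h < i" "0 < j" "j < k" and corners: "(i, j) \<in> D" "(h, j) \<notin> D" "(i, k) \<notin> D" "(h, k) \<notin> D"
    and full: "\<And>r c. h \<le> r \<Longrightarrow> r \<le> i \<Longrightarrow> j \<le> c \<Longrightarrow> c \<le> k \<Longrightarrow>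
      (r, c) \<notin> {(h, j), (i, k), (h, k)} \<Longrightarrow> (r, c) \<in> D"
    using R by (auto simp: ladder_rectangle_def)
  have aj: "a i \<noteq> j" using corners(1) a_bump by auto
  have left: "(r, c) \<in> ?X \<longleftrightarrow> (r, c) \<in> D" if "0 < r" "c \<le> a r" for r c
    using that insert_left[of c "r - 1"] by simp
  note eq = insert_ladder[OF ak aj]
  consider "k \<le> a i" | "a h \<le> j" | "a i < k" "k < a h"
    using path_outside_rectangle[OF R ak, of h] pos by atomize_elim auto
  then show ?thesis
  proof cases
    case 1
    have X: "(r, c) \<in> ?X \<longleftrightarrow> (r, c) \<in> D" if "h \<le> r" "r \<le> i" "c \<le> k" for r c
      using that 1 a_anti[of r i] pos by (intro left) auto
    have "ladder_rectangle ?X h i j k"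
      unfolding ladder_rectangle_def
    proof (intro conjI subsetI)
      fix x assume "x \<in> {h..i} \<times> {j..k} - {(h, j), (i, k), (h, k)}"
      then show "x \<in> ?X" using X full by (cases x) auto
    qed (use pos corners X in auto)
    moreover have "k < a h" using 1 ak a_anti[of h i] pos by simp
    ultimately show ?thesis using eq pos 1 by (auto simp: ladder_step_def)
  next
    case 2
    have X: "(Suc r, c) \<in> ?X \<longleftrightarrow> (r, c) \<in> D" if "h \<le> r" "j \<le> c" for r c
      using that 2 a_anti[of h r] by (intro insert_right) auto
    have "ladder_rectangle ?X (Suc h) (Suc i) j k"
      unfolding ladder_rectangle_def
    proof (intro conjI subsetI)
      fix x assume "x \<in> {Suc h..Suc i} \<times> {j..k} - {(Suc h, j), (Suc i, k), (Suc h, k)}"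
      then obtain r c where "x = (Suc r, c)" "h \<le> r" "r \<le> i" "j \<le> c" "c \<le> k"
        "(r, c) \<notin> {(h, j), (i, k), (h, k)}"
        by (cases x; cases "fst x") auto
      then show "x \<in> ?X" using X full by auto
    qed (use pos corners X in auto)
    moreover have "\<not> k < a h" "\<not> j < a i" using 2 a_anti[of h i] pos by auto
    ultimately show ?thesis using eq pos by (auto simp: ladder_step_def)
  next
    case 3
    have aij: "a i < j" using path_corner_less[OF R 3(1)] .
    \<comment> \<open>The path traverses the rectangle in row \<open>r0 = Suc s\<close>: on leaving
      row \<open>s\<close> it must still be right of column \<open>k\<close>.\<close>
    define r0 where "r0 = (LEAST r. a r < j)"
    have r0: "a r0 < j" "r0 \<le> i" and r0_least: "\<And>r. r < r0 \<Longrightarrow> j \<le> a r"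
      unfolding r0_def using aij by (auto intro: LeastI Least_le dest: not_less_Least)
    have "h < r0" using r0(1) 3(2) pos a_anti[of r0 h] by (cases "h < r0") auto
    then obtain s where s: "r0 = Suc s" "h \<le> s" "s < i" using r0 by (cases r0) auto
    have "k < a s"
    proof (rule ccontr)
      assume "\<not> k < a s"
      then have "a s = j" "h < s" using path_outside_rectangle[OF R ak, of s] s r0_least[of s] 3(2)
        by (auto simp: le_less)
      then have "(s, a s) \<in> D" using full[of s j] s pos by auto
      then show False using a_bump by simp
    qed
    have lo: "(r, c) \<in> ?X \<longleftrightarrow> (r, c) \<in> D" if "h \<le> r" "r \<le> s" "c \<le> k" for r c
      using that \<open>k < a s\<close> a_anti[of r s] pos by (intro left) auto
    have hi: "(Suc r, c) \<in> ?X \<longleftrightarrow> (r, c) \<in> D" if "s < r" "j \<le> c" for r c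
      using that r0(1) s a_anti[of "Suc s" r] by (intro insert_right) auto
    have mid: "(Suc s, c) \<in> ?X" if "j \<le> c" "c \<le> k" for c
      using that r0(1) s \<open>k < a s\<close> by (intro insert_mid) auto
    have "ladder_rectangle ?X h (Suc i) j k"
      unfolding ladder_rectangle_def
    proof (intro conjI subsetI)
      fix x assume x: "x \<in> {h..Suc i} \<times> {j..k} - {(h, j), (Suc i, k), (h, k)}"
      obtain r c where rc: "x = (r, c)" by (cases x)
      consider "r \<le> s" | "r = Suc s" | q where "r = Suc q" "s < q" by (cases r) (atomize_elim, auto)+
      then show "x \<in> ?X"
      proof cases
        case 1
        then show ?thesis using x rc lo[of r c] full[of r c] s by auto
      next
        case 2
        then show ?thesis using x rc mid[of c] by auto
      next
        case 3
        then show ?thesis using x rc hi[of q c] full[of q c] s by auto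
      qed
    qed (use pos corners lo[of h j] lo[of h k] hi[of i j] hi[of i k] s in auto)
    moreover have "\<not> j < a i" using aij by simp
    ultimately show ?thesis using eq pos 3 by (auto simp: ladder_step_def)
  qed
qed

text \<open>When \<open>a h\<close> moves to the next bump on its left, the horizontal run of the
  new pipe between the two bumps goes from row \<open>Suc h\<close> to row \<open>h\<close>; the
  crosses of \<open>D\<close> there complete a ladder rectangle with two rows.\<close>

lemma shift_path:
  assumes h: "0 < h" and j: "0 < j" "j < a h" "(h, j) \<notin> D" "a (Suc h) < j"
    and full: "\<And>c. j < c \<Longrightarrow> c < a h \<Longrightarrow> (h, c) \<in> D"
  shows "pipe_path (Suc n) m D (a(h := j))"
    and "ladder_rectangle (insert_pipe a D) h (Suc h) j (a h)"
    and "insert_pipe (a(h := j)) D = ladder h (Suc h) j (a h) (insert_pipe a D)"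
proof -
  let ?X = "insert_pipe a D"
  obtain g where g: "h = Suc g" using h by (cases h) auto
  have hm: "h < m" using a_pos[of h] j by simp
  have ag: "a h < a g" using a_dec[of g] hm g by simp
  show p: "pipe_path (Suc n) m D (a(h := j))"
    unfolding pipe_path_def
  proof (intro conjI allI impI)
    show "(a(h := j)) 0 = Suc n" using h a0 by simp
    show "(0 < (a(h := j)) r) = (r < m)" for r using a_pos[of r] hm j by auto
    show "(a(h := j)) (Suc r) < (a(h := j)) r" if "r < m" for r
      using a_dec[OF that] j ag g by auto
    show "(r, (a(h := j)) r) \<notin> D" for r using a_bump j by auto
  qed
  have row: "(h, c) \<in> ?X \<longleftrightarrow> (h, c) \<in> D" if "c \<le> a h" for c
    using insert_left[of c g] g that by simp
  have row': "(Suc h, c) \<in> ?X" if "j \<le> c" "c < a h" for c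
    using insert_mid[of h c] j that by simp
  have bumps: "(h, a h) \<notin> ?X" "(Suc h, a h) \<notin> ?X" "(h, j) \<notin> ?X"
    using insert_right[of h "a h"] row[of "a h"] row[of j] a_bump j by auto
  show "ladder_rectangle ?X h (Suc h) j (a h)"
    unfolding ladder_rectangle_def
  proof (intro conjI subsetI)
    fix x assume x: "x \<in> {h..Suc h} \<times> {j..a h} - {(h, j), (Suc h, a h), (h, a h)}"
    then obtain r c where rc: "x = (r, c)" "j \<le> c" "c \<le> a h" "r = h \<or> r = Suc h"
      by (cases x) (auto simp: le_Suc_eq)
    show "x \<in> ?X"
    proof (cases "r = h")
      case True
      then have "j < c" "c < a h" using x rc by (auto simp: le_less)
      then show ?thesis using row[of c] full[of c] rc True by auto
    next
      case False
      then have "c < a h" using x rc by (auto simp: le_less)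
      then show ?thesis using row' rc False by auto
    qed
  qed (use h j bumps row' in auto)
  interpret B: inserted n m D "a(h := j)" using D p by unfold_locales
  show "insert_pipe (a(h := j)) D = ladder h (Suc h) j (a h) ?X" (is "?Y = ?R")
  proof -
    have "(Suc r, c) \<in> ?Y \<longleftrightarrow> (Suc r, c) \<in> ?R" for r c
    proof -
      consider "Suc r \<noteq> h" "r \<noteq> h" | "Suc r = h" | "r = h" by blast
      then show ?thesis
      proof cases
        case 1
        then show ?thesis by (auto simp: insert_pipe_def ladder_def)
      next
        case 2
        then have r: "r = g" using g by simp
        consider "c \<le> j" | "j < c" "c < a h" | "c = a h" | "a h < c" "c < a g" | "a g \<le> c" by linarith
        then show ?thesis
        proof cases
          case 1
          then show ?thesis using B.insert_left[of c g] row[of c] g r j by (auto simp: ladder_def)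
        next
          case 2
          then show ?thesis using B.insert_mid[of g c] row[of c] full[of c] g r ag by (auto simp: ladder_def)
        next
          case 3
          then show ?thesis using B.insert_mid[of g c] g r j ag by (auto simp: ladder_def)
        next
          case 4
          then show ?thesis using B.insert_mid[of g c] insert_mid[of g c] g r j by (auto simp: ladder_def)
        next
          case 5
          then show ?thesis using B.insert_right[of g c] insert_right[of g c] g r ag by (auto simp: ladder_def)
        qed
      next
        case 3
        consider "c \<le> a (Suc h)" | "a (Suc h) < c" "c < j" | "c = j" | "j < c" "c < a h" | "a h \<le> c" by linarith
        then show ?thesis
        proof cases
          case 1
          then show ?thesis using B.insert_left[of c h] insert_left[of c h] 3 j by (auto simp: ladder_def)
        next
          case 2
          then show ?thesis using B.insert_mid[of h c] insert_mid[of h c] 3 j by (auto simp: ladder_def)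
        next
          case 3
          then show ?thesis using B.insert_right[of h c] \<open>r = h\<close> j by (auto simp: ladder_def)
        next
          case 4
          then show ?thesis using B.insert_right[of h c] row'[of c] full[of c] 3 by (auto simp: ladder_def)
        next
          case 5
          then show ?thesis using B.insert_right[of h c] insert_right[of h c] 3 j by (auto simp: ladder_def)
        qed
      qed
    qed
    moreover have "(0, c) \<in> ?Y \<longleftrightarrow> (0, c) \<in> ?R" for c
      using h by (auto simp: insert_pipe_def ladder_def)
    ultimately have "(r, c) \<in> ?Y \<longleftrightarrow> (r, c) \<in> ?R" for r c
      by (cases r) auto
    then show ?thesis by auto
  qed
qed

text \<open>If \<open>a h = k\<close>, the move only shifts the path in row \<open>h\<close>.
  Otherwise the path passes right of the rectangle, through it or left of it, as in
  \<open>lift_ladder\<close>, and the rectangle comes from \<open>D\<close>.\<close>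

lemma project_ladder:
  assumes R: "ladder_rectangle (insert_pipe a D) h i j k"
  obtains (shift) "0 < h" "0 < j" "j < a h" "(h, j) \<notin> D" "a (Suc h) < j"
      "\<And>c. j < c \<Longrightarrow> c < a h \<Longrightarrow> (h, c) \<in> D" "i = Suc h" "k = a h"
    | (lift) h' i' where "ladder_rectangle D h' i' j k" "a h' \<noteq> k"
      "ladder h i j k (insert_pipe a D) = insert_pipe a (ladder h' i' j k D)"
proof -
  let ?X = "insert_pipe a D"
  have pos: "0 < h" "h < i" "0 < j" "j < k" and corners: "(i, j) \<in> ?X" "(h, j) \<notin> ?X" "(i, k) \<notin> ?X" "(h, k) \<notin> ?X"
    and full: "\<And>r c. h \<le> r \<Longrightarrow> r \<le> i \<Longrightarrow> j \<le> c \<Longrightarrow> c \<le> k \<Longrightarrow>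
      (r, c) \<notin> {(h, j), (i, k), (h, k)} \<Longrightarrow> (r, c) \<in> ?X"
    using R by (auto simp: ladder_rectangle_def)
  obtain g where g: "h = Suc g" using pos by (cases h) auto
  obtain i' where i': "i = Suc i'" using pos by (cases i) auto
  have left: "(r, c) \<in> ?X \<longleftrightarrow> (r, c) \<in> D" if "0 < r" "c \<le> a r" for r c
    using that insert_left[of c "r - 1"] by simp
  have bumpX: "(r, a r) \<notin> ?X" if "0 < r" for r
    using left[of r "a r"] a_bump that by simp
  consider "a h = k" | "k < a h" "k \<le> a i" | "k < a h" "a i < k" | "a h < k" by linarith
  then show thesis
  proof cases
    case 1
    \<comment> \<open>The bump \<open>(h, a h)\<close> of \<open>D\<close> reappears as a bump at
      \<open>(Suc h, k)\<close>, so the rectangle has only two rows.\<close>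
    have "(Suc h, k) \<notin> ?X" using insert_right[of h k] 1 a_bump by auto
    then have i: "i = Suc h" using full[of "Suc h" k] pos by auto
    have ah: "a (Suc h) < k" using a_strict[of h "Suc h"] 1 pos by auto
    have "a (Suc h) < j"
      using bumpX[of "Suc h"] full[of "Suc h" "a (Suc h)"] ah i by force
    moreover have "(h, c) \<in> D" if "j < c" "c < a h" for c
      using that 1 pos left[of h c] full[of h c] by auto
    ultimately show thesis
      using 1 i pos corners(2) left[of h j] by (intro shift) auto
  next
    case 2
    have X: "(r, c) \<in> ?X \<longleftrightarrow> (r, c) \<in> D" if "h \<le> r" "r \<le> i" "c \<le> k" for r c
      using that 2 a_anti[of r i] pos by (intro left) auto
    have RD: "ladder_rectangle D h i j k"
      unfolding ladder_rectangle_def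
    proof (intro conjI subsetI)
      fix x assume "x \<in> {h..i} \<times> {j..k} - {(h, j), (i, k), (h, k)}"
      then show "x \<in> D" using X full by (cases x) auto
    qed (use pos corners X in auto)
    have "a i \<noteq> j" using 2 pos by simp
    then show thesis using 2 RD pos insert_ladder[of h k i j] by (intro lift[of h i]) auto
  next
    case 3
    \<comment> \<open>The path traverses the rectangle in row \<open>r0 = Suc s\<close>. As
      \<open>(Suc s, k)\<close> is a cross, this is not the last row, and deleting it leaves a
      rectangle of \<open>D\<close>.\<close>
    define r0 where "r0 = (LEAST r. a r < k)"
    have r0: "a r0 < k" "r0 \<le> i" and r0_least: "\<And>r. r < r0 \<Longrightarrow> k \<le> a r"
      unfolding r0_def using 3 by (auto intro: LeastI Least_le dest: not_less_Least)
    have "h < r0" using r0(1) 3(1) a_anti[of r0 h] by (cases "h < r0") auto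
    then obtain s where s: "r0 = Suc s" "h \<le> s" "s < i" using r0 by (cases r0) auto
    have ks: "k < a s"
    proof (rule ccontr)
      assume "\<not> k < a s"
      then have "a s = k" using r0_least[of s] s by simp
      moreover from this have "h < s" using 3 s by (auto simp: le_less)
      ultimately show False using full[of s k] bumpX[of s] s pos by auto
    qed
    have "(Suc s, k) \<in> ?X" using insert_mid r0 s ks by simp
    then have si: "Suc s < i" using corners(3) s by (metis Suc_lessI)
    have asj: "a (Suc s) < j"
    proof (rule ccontr)
      assume "\<not> ?thesis"
      then have "(Suc s, a (Suc s)) \<in> ?X" using full[of "Suc s" "a (Suc s)"] s si r0 by auto
      then show False using bumpX by simp
    qed
    have lo: "(r, c) \<in> ?X \<longleftrightarrow> (r, c) \<in> D" if "h \<le> r" "r \<le> s" "c \<le> k" for r c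
      using that ks a_anti[of r s] pos by (intro left) auto
    have hi: "(Suc r, c) \<in> ?X \<longleftrightarrow> (r, c) \<in> D" if "s < r" "j \<le> c" for r c
      using that asj a_anti[of "Suc s" r] by (intro insert_right) auto
    have RD: "ladder_rectangle D h i' j k"
      unfolding ladder_rectangle_def
    proof (intro conjI subsetI)
      fix x assume x: "x \<in> {h..i'} \<times> {j..k} - {(h, j), (i', k), (h, k)}"
      obtain r c where rc: "x = (r, c)" by (cases x)
      show "x \<in> D"
      proof (cases "r \<le> s")
        case True
        then show ?thesis using x rc lo[of r c] full[of r c] i' si by auto
      next
        case False
        then show ?thesis using x rc hi[of r c] full[of "Suc r" c] i' s by auto
      qed
    qed (use pos corners lo[of h j] lo[of h k] hi[of i' j] hi[of i' k] s si i' in auto)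
    have "a i' < j" using asj a_anti[of "Suc s" i'] si i' by simp
    then show thesis using 3 RD pos i' insert_ladder[of h k i' j] si by (intro lift[of h i']) auto
  next
    case 4
    \<comment> \<open>The path is left of the rectangle already when it leaves row \<open>g\<close>:
      a run over \<open>(h, k)\<close> or \<open>(h, j)\<close> would make that tile a cross, and a
      turn inside row \<open>h\<close> would leave a forbidden bump.\<close>
    have gk: "a g \<le> k" using insert_mid[of g k] 4 corners(4) g by force
    have "j \<le> a h \<or> a g \<le> j" using insert_mid[of g j] corners(2) g by force
    moreover have "\<not> j \<le> a h"
    proof
      assume "j \<le> a h"
      then have "a h = j" using bumpX[of h] full[of h "a h"] 4 pos by force
      then have "(Suc h, j) \<notin> ?X" using insert_right[of h j] a_bump[of h] by auto
      then show False using full[of "Suc h" j] pos by auto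
    qed
    ultimately have gj: "a g \<le> j" by simp
    have X: "(Suc r, c) \<in> ?X \<longleftrightarrow> (r, c) \<in> D" if "g \<le> r" "j \<le> c" for r c
      using that gj a_anti[of g r] by (intro insert_right) auto
    have "(i', j) \<in> D" using X[of i' j] corners(1) i' g pos by simp
    then have "0 < g" using gj a0 D_pos[of i' j] by (cases g) auto
    have RD: "ladder_rectangle D g i' j k"
      unfolding ladder_rectangle_def
    proof (intro conjI subsetI)
      fix x assume x: "x \<in> {g..i'} \<times> {j..k} - {(g, j), (i', k), (g, k)}"
      obtain r c where rc: "x = (r, c)" by (cases x)
      then show "x \<in> D" using x X[of r c] full[of "Suc r" c] i' g by auto
    qed (use pos corners X[of g j] X[of g k] X[of i' j] X[of i' k] i' g \<open>0 < g\<close> in auto)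
    have "a i' \<le> j" using gj a_anti[of g i'] pos g i' by simp
    moreover have "a i' \<noteq> j" using \<open>(i', j) \<in> D\<close> a_bump[of i'] by auto
    ultimately show thesis using RD gj pos i' g \<open>0 < g\<close> insert_ladder[of g k i' j]
      by (intro lift[of g i']) auto
  qed
qed

end

section \<open>Joins and lower bounds\<close>

lemma ladder_stepE:
  assumes "ladder_step D E"
  obtains h i j k where "ladder_rectangle D h i j k" "E = ladder h i j k D"
  using assms by (auto simp: ladder_step_def)

lemma RP_staircase: "D \<in> RP n \<Longrightarrow> D \<subseteq> staircase n"
  by (simp add: RP_def)

text \<open>The sets \<open>west\<close> can only shrink: a shift moves the path to the left, and a
  lifted move keeps them because the path avoids the rectangle.\<close>

lemma project_step:
  assumes D: "D \<in> RP n" and a: "pipe_path (Suc n) m D a" and step: "ladder_step (insert_pipe a D) Y"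
  obtains E b where "Y = insert_pipe b E" "pipe_path (Suc n) m E b" "ladder_step D E \<or> E = D"
    "\<And>r. west E r (b r) \<subseteq> west D r (a r)"
proof -
  interpret inserted n m D a using RP_staircase[OF D] a by unfold_locales
  obtain h i j k where R: "ladder_rectangle (insert_pipe a D) h i j k"
    and Y: "Y = ladder h i j k (insert_pipe a D)"
    using step by (rule ladder_stepE)
  show thesis
    using R
  proof (cases rule: project_ladder)
    case shift
    show thesis
    proof (rule that)
      show "Y = insert_pipe (a(h := j)) D"
        using shift_path(3)[OF shift(1-6)] Y shift(7,8) by simp
      show "pipe_path (Suc n) m D (a(h := j))"
        using shift_path(1)[OF shift(1-6)] .
      show "west D r ((a(h := j)) r) \<subseteq> west D r (a r)" for r
        using shift(3) west_mono[of j "a h" D h] by auto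
    qed simp
  next
    case (lift h' i')
    interpret rectangle D h' i' j k using finD lift(1) by unfold_locales
    show thesis
    proof (rule that)
      show "pipe_path (Suc n) m E a" using pipe_path_ladder lift(2) .
      show "west E r (a r) \<subseteq> west D r (a r)" for r
        using west_ladder[of r "a r"] path_outside_rectangle[OF lift(1,2)] by blast
      show "ladder_step D E \<or> E = D" using lift(1) by (auto simp: ladder_step_def)
    qed (use Y lift(3) in simp)
  qed
qed

text \<open>Induction by deleting the last pipe: the move becomes a move or nothing on the smaller
  pipe dream, and inserting the new path preserves reducedness.\<close>

lemma RP_step:
  assumes "D \<in> RP n" "ladder_step D E"
  shows "E \<in> RP n"
  using assms
proof (induction n arbitrary: D E)
  case 0
  then show ?case
    by (auto simp: RP_def staircase_def ladder_step_def ladder_rectangle_def)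
next
  case (Suc n)
  obtain m D' a where D': "D' \<in> RP n" "pipe_path (Suc n) m D' a" "D = insert_pipe a D'"
    using remove_pipe[OF Suc.prems(1)] .
  obtain E' b where E': "E = insert_pipe b E'" "pipe_path (Suc n) m E' b" "ladder_step D' E' \<or> E' = D'"
    using project_step[OF D'(1,2)] Suc.prems(2) D'(3) by metis
  have RP: "E' \<in> RP n" using Suc.IH D'(1) E'(3) by blast
  interpret inserted n m E' b using RP_staircase[OF RP] E'(2) by unfold_locales
  show ?case using insert_RP[OF RP] E'(1) by simp
qed

lemma step_state_exit:
  assumes "finite D" "ladder_step D E"
  shows "state E r 0 = state D r 0"
proof -
  obtain h i j k where R: "ladder_rectangle D h i j k" "E = ladder h i j k D"
    using assms(2) by (rule ladder_stepE)
  interpret rectangle D h i j k using assms(1) R(1) by unfold_locales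
  show ?thesis using state_ladder[of r 0] pos R(2) by (auto simp: transpose_def)
qed

lemma RP_steps:
  assumes "ladder_step\<^sup>*\<^sup>* D E" "D \<in> RP n"
  shows "E \<in> RP n \<and> lehmer_le D E r \<and> state E r 0 = state D r 0"
  using assms
proof (induction rule: rtranclp_induct)
  case (step E F)
  obtain h i j k where R: "ladder_rectangle E h i j k" "F = ladder h i j k E"
    using step(2) by (rule ladder_stepE)
  have "E \<in> RP n" using step by simp
  interpret reduced_rectangle E h i j k
    using RP_finite[OF \<open>E \<in> RP n\<close>] R(1) \<open>E \<in> RP n\<close> by unfold_locales (simp_all add: RP_def)
  show ?case
    using step RP_step step_state_exit[OF finD] lehmer_le_ladder[of r] R(2) lehmer_le_trans by auto
qed (simp add: lehmer_le_refl)

lemma project_steps: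
  assumes "ladder_step\<^sup>*\<^sup>* X Y" "X = insert_pipe a D" "D \<in> RP n" "pipe_path (Suc n) m D a"
  obtains E b where "Y = insert_pipe b E" "E \<in> RP n" "pipe_path (Suc n) m E b" "ladder_step\<^sup>*\<^sup>* D E"
    "\<And>r. west E r (b r) \<subseteq> west D r (a r)"
proof -
  have "\<exists>E b. Y = insert_pipe b E \<and> E \<in> RP n \<and> pipe_path (Suc n) m E b \<and> ladder_step\<^sup>*\<^sup>* D E \<and>
    (\<forall>r. west E r (b r) \<subseteq> west D r (a r))"
    using assms(1)
  proof (induction rule: rtranclp_induct)
    case base
    then show ?case using assms by blast
  next
    case (step Y Z)
    then obtain E b where E: "Y = insert_pipe b E" "E \<in> RP n" "pipe_path (Suc n) m E b"
      "ladder_step\<^sup>*\<^sup>* D E" "\<And>r. west E r (b r) \<subseteq> west D r (a r)"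
      by blast
    obtain F c where F: "Z = insert_pipe c F" "pipe_path (Suc n) m F c" "ladder_step E F \<or> F = E"
      "\<And>r. west F r (c r) \<subseteq> west E r (b r)"
      using project_step[OF E(2,3)] step(2) E(1) by metis
    have "F \<in> RP n" using F(3) RP_step E(2) by blast
    moreover have "ladder_step\<^sup>*\<^sup>* D F"
      using F(3) E(4) by (auto intro: rtranclp.rtrancl_into_rtrancl)
    moreover have "west F r (c r) \<subseteq> west D r (a r)" for r using F(4) E(5) by blast
    ultimately show ?case using F(1,2) by blast
  qed
  then show ?thesis using that by blast
qed

text \<open>The path is lowered one bump at a time, always in the last row where it differs from
  \<open>b\<close>; the next row then agrees with \<open>b\<close> and leaves room for the
  shift.\<close>

lemma fibre_steps:
  assumes D: "D \<subseteq> staircase n" and "pipe_path (Suc n) m D a" "pipe_path (Suc n) m D b" "\<And>r. b r \<le> a r"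
  shows "ladder_step\<^sup>*\<^sup>* (insert_pipe a D) (insert_pipe b D)"
  using assms(2,4)
proof (induction "\<Sum>r<m. a r - b r" arbitrary: a rule: less_induct)
  case less
  interpret A: inserted n m D a using D less(2) by unfold_locales
  interpret B: inserted n m D b using D assms(3) by unfold_locales
  show ?case
  proof (cases "a = b")
    case False
    then obtain r where r: "b r \<noteq> a r" by (metis ext)
    have bound: "q < m" if "b q \<noteq> a q" for q
      using A.a_zero[of q] B.a_zero[of q] that by (cases "q < m") auto
    define h where "h = Max {q. q < m \<and> b q \<noteq> a q}"
    have "finite {q. q < m \<and> b q \<noteq> a q}" "{q. q < m \<and> b q \<noteq> a q} \<noteq> {}"
      using r bound by auto
    then have h: "h < m" "b h \<noteq> a h" and hmax: "\<And>q. b q \<noteq> a q \<Longrightarrow> q \<le> h"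
      using Max_in[of "{q. q < m \<and> b q \<noteq> a q}"] bound by (auto simp: h_def)
    have h0: "0 < h" using h A.a0 B.a0 by (cases h) auto
    have bh: "b h < a h" "0 < b h" using h less(3)[of h] B.a_pos[of h] by auto
    \<comment> \<open>\<open>j\<close> is the next bump to the left of \<open>a h\<close>. As
      \<open>b h\<close> is one of the bumps in \<open>S\<close>, the shift does not pass
      \<open>b\<close>.\<close>
    define S where "S = {c. c < a h \<and> (h, c) \<notin> D}"
    define j where "j = Max S"
    have "finite S" and bS: "b h \<in> S" using bh B.a_bump by (auto simp: S_def)
    have "j \<in> S" and jmax: "\<And>c. c \<in> S \<Longrightarrow> c \<le> j"
      unfolding j_def using Max_in[of S] \<open>finite S\<close> bS by (blast, simp)
    then have j: "j < a h" "(h, j) \<notin> D" "b h \<le> j"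
      using bS by (auto simp: S_def)
    have full: "(h, c) \<in> D" if "j < c" "c < a h" for c
      using jmax[of c] that by (auto simp: S_def)
    have "a (Suc h) = b (Suc h)" using hmax[of "Suc h"] by (metis Suc_n_not_le_n)
    then have ash: "a (Suc h) < j" using B.a_dec[OF h(1)] j(3) by simp
    have j0: "0 < j" using bh j by simp
    note sh = A.shift_path[OF h0 j0 j(1,2) ash full]
    have "(\<Sum>r<m. (a(h := j)) r - b r) < (\<Sum>r<m. a r - b r)"
    proof (rule sum_strict_mono_ex1)
      show "\<exists>r\<in>{..<m}. (a(h := j)) r - b r < a r - b r"
        using h j bh by (intro bexI[of _ h]) auto
    qed (use j in auto)
    moreover have "b r \<le> (a(h := j)) r" for r using less(3)[of r] j(3) by auto
    ultimately have "ladder_step\<^sup>*\<^sup>* (insert_pipe (a(h := j)) D) (insert_pipe b D)"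
      using less(1) sh(1) by blast
    moreover have "ladder_step (insert_pipe a D) (insert_pipe (a(h := j)) D)"
      using sh(2,3) by (auto simp: ladder_step_def)
    ultimately show ?thesis by (rule converse_rtranclp_into_rtranclp[rotated])
  qed auto
qed

text \<open>If the target of the move is off the path, the path stays. If \<open>a h = k\<close>, it
  is first shifted to \<open>j\<close>; by \<open>west_blocked\<close>, this does not exclude any
  \<open>(F, c)\<close> with \<open>F\<close> above \<open>E\<close> that satisfied the bound for
  \<open>(D, a)\<close>.\<close>

lemma push_step:
  assumes DRP: "D \<in> RP n" and a: "pipe_path (Suc n) m D a" and step: "ladder_step D E"
  obtains b where "pipe_path (Suc n) m E b" "ladder_step\<^sup>*\<^sup>* (insert_pipe a D) (insert_pipe b E)"
    "\<And>F c. \<lbrakk>ladder_step\<^sup>*\<^sup>* E F; pipe_path (Suc n) m F c; \<And>r. west F r (c r) \<subseteq> west D r (a r)\<rbrakk> \<Longrightarrow>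
      \<forall>r. west F r (c r) \<subseteq> west E r (b r)"
proof -
  interpret inserted n m D a using RP_staircase[OF DRP] a by unfold_locales
  obtain h i j k where R: "ladder_rectangle D h i j k" and E: "E = ladder h i j k D"
    using step by (rule ladder_stepE)
  interpret R: reduced_rectangle D h i j k
    using finD R DRP by unfold_locales (simp_all add: RP_def)
  show thesis
  proof (cases "a h = k")
    case False
    show thesis
    proof (rule that)
      show "pipe_path (Suc n) m E a" using pipe_path_ladder[OF False] E by simp
      show "ladder_step\<^sup>*\<^sup>* (insert_pipe a D) (insert_pipe a E)"
        using lift_ladder[OF R False] E by auto
      show "\<forall>r. west F r (c r) \<subseteq> west E r (a r)" if "\<And>r. west F r (c r) \<subseteq> west D r (a r)" for F c
        using that R.west_ladder path_outside_rectangle[OF R False] E by simp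
    qed
  next
    case True
    have full: "(r, c) \<in> D" if "h < r" "r \<le> i" "j \<le> c" "c < k" for r c
      using R.full[of r c] that by auto
    have "a (Suc h) < k" using a_strict[of h "Suc h"] True R.pos by simp
    then have ash: "a (Suc h) < j"
      using full[of "Suc h" "a (Suc h)"] a_bump[of "Suc h"] R.pos by (cases "a (Suc h) < j") auto
    have row: "(h, c) \<in> D" if "j < c" "c < a h" for c
      using R.full[of h c] that True R.pos by auto
    have jh: "j < a h" using True R.pos by simp
    note sh = shift_path[OF R.pos(1,3) jh R.corners(2) ash row]
    define b where "b = a(h := j)"
    interpret B: inserted n m D b using D sh(1) by unfold_locales (auto simp: b_def)
    have bh: "b h \<noteq> k" using R.pos by (simp add: b_def)
    show thesis
    proof (rule that)
      show "pipe_path (Suc n) m E b" using B.pipe_path_ladder[OF bh] E by simp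
      have "ladder_step (insert_pipe a D) (insert_pipe b D)"
        using sh(2,3) by (auto simp: ladder_step_def b_def)
      moreover have "ladder_step (insert_pipe b D) (insert_pipe b E)"
        using B.lift_ladder[OF R bh] E by simp
      ultimately show "ladder_step\<^sup>*\<^sup>* (insert_pipe a D) (insert_pipe b E)"
        by (meson r_into_rtranclp rtranclp.rtrancl_into_rtrancl)
      fix F c assume F: "ladder_step\<^sup>*\<^sup>* E F" "pipe_path (Suc n) m F c"
        "\<And>r. west F r (c r) \<subseteq> west D r (a r)"
      have ERP: "E \<in> RP n" using RP_step[OF DRP step] .
      have west_eq: "west E r (b r) = west D r (b r)" for r
        using R.west_ladder B.path_outside_rectangle[OF R bh] E by simp
      have "west F r (c r) \<subseteq> west D r (b r)" for r
      proof (cases "r = h")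
        case True
        have "west F h (c h) \<subseteq> west D h k" using F(3)[of h] \<open>a h = k\<close> by simp
        then have "west F h (c h) \<subseteq> west D h j"
          using R.west_blocked[of F "c h"] RP_steps[OF F(1) ERP, of h] RP_finite E by blast
        then show ?thesis using True by (simp add: b_def)
      next
        case False
        then show ?thesis using F(3)[of r] by (simp add: b_def)
      qed
      then show "\<forall>r. west F r (c r) \<subseteq> west E r (b r)" using west_eq by simp
    qed
  qed
qed

text \<open>Optimality composes because every \<open>F\<close> above the end of the chain is above
  each intermediate pipe dream, so its bound is handed on step by step.\<close>

lemma push_steps:
  assumes "ladder_step\<^sup>*\<^sup>* D E" "D \<in> RP n" "pipe_path (Suc n) m D a"
  obtains b where "pipe_path (Suc n) m E b" "ladder_step\<^sup>*\<^sup>* (insert_pipe a D) (insert_pipe b E)"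
    "\<And>F c. \<lbrakk>ladder_step\<^sup>*\<^sup>* E F; pipe_path (Suc n) m F c; \<And>r. west F r (c r) \<subseteq> west D r (a r)\<rbrakk> \<Longrightarrow>
      \<forall>r. west F r (c r) \<subseteq> west E r (b r)"
proof -
  have "\<exists>b. pipe_path (Suc n) m E b \<and> ladder_step\<^sup>*\<^sup>* (insert_pipe a D) (insert_pipe b E) \<and>
    (\<forall>F c. ladder_step\<^sup>*\<^sup>* E F \<longrightarrow> pipe_path (Suc n) m F c \<longrightarrow> (\<forall>r. west F r (c r) \<subseteq> west D r (a r)) \<longrightarrow>
      (\<forall>r. west F r (c r) \<subseteq> west E r (b r)))"
    using assms(1)
  proof (induction rule: rtranclp_induct)
    case base
    then show ?case using assms by blast
  next
    case (step E E')
    obtain b where b: "pipe_path (Suc n) m E b" "ladder_step\<^sup>*\<^sup>* (insert_pipe a D) (insert_pipe b E)"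
      "\<And>F c. \<lbrakk>ladder_step\<^sup>*\<^sup>* E F; pipe_path (Suc n) m F c; \<forall>r. west F r (c r) \<subseteq> west D r (a r)\<rbrakk> \<Longrightarrow>
      \<forall>r. west F r (c r) \<subseteq> west E r (b r)"
      using step.IH by blast
    have "E \<in> RP n" using RP_steps[OF step(1) assms(2)] by blast
    then obtain b' where b': "pipe_path (Suc n) m E' b'"
      "ladder_step\<^sup>*\<^sup>* (insert_pipe b E) (insert_pipe b' E')"
      "\<And>F c. \<lbrakk>ladder_step\<^sup>*\<^sup>* E' F; pipe_path (Suc n) m F c; \<And>r. west F r (c r) \<subseteq> west E r (b r)\<rbrakk> \<Longrightarrow>
      \<forall>r. west F r (c r) \<subseteq> west E' r (b' r)"
      using push_step[OF _ b(1) step(2)] by blast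
    show ?case
    proof (intro exI[of _ b'] conjI allI impI)
      show "ladder_step\<^sup>*\<^sup>* (insert_pipe a D) (insert_pipe b' E')" using b(2) b'(2) by simp
      fix F c r assume F: "ladder_step\<^sup>*\<^sup>* E' F" "pipe_path (Suc n) m F c" "\<forall>r. west F r (c r) \<subseteq> west D r (a r)"
      have "ladder_step\<^sup>*\<^sup>* E F" using step(2) F(1) by (rule converse_rtranclp_into_rtranclp)
      then show "west F r (c r) \<subseteq> west E' r (b' r)" using b(3) b'(3) F by blast
    qed (rule b'(1))
  qed
  then show thesis using that by blast
qed

text \<open>Undoing the move under the same path fails only if the cross to be restored at
  \<open>(i, j)\<close> lies on the path. Then the path is first moved right to the bump
  \<open>(i, k)\<close>, which a shift after the move of \<open>D\<close> reverses.\<close>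

lemma pull_step:
  assumes D: "D \<in> RP n" and b: "pipe_path (Suc n) m E b" and step: "ladder_step D E"
  obtains a where "pipe_path (Suc n) m D a" "ladder_step\<^sup>*\<^sup>* (insert_pipe a D) (insert_pipe b E)"
proof -
  obtain h i j k where R: "ladder_rectangle D h i j k" and E: "E = ladder h i j k D"
    using step by (rule ladder_stepE)
  have ERP: "E \<in> RP n" using RP_step[OF D step] .
  interpret R: rectangle D h i j k using RP_finite[OF D] R by unfold_locales
  interpret B: inserted n m E b using RP_staircase[OF ERP] b by unfold_locales
  have DE: "(r, c) \<in> E \<longleftrightarrow> (r, c) = (h, k) \<or> (r, c) \<in> D \<and> (r, c) \<noteq> (i, j)" for r c
    using R.mem_E E by simp
  have bh: "b h \<noteq> k" using B.a_bump[of h] DE by auto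
  show thesis
  proof (cases "b i = j")
    case False
    have p: "pipe_path (Suc n) m D b"
      using b False DE by (auto simp: pipe_path_def)
    interpret A: inserted n m D b using RP_staircase[OF D] p by unfold_locales
    show thesis using that[OF p] A.lift_ladder[OF R bh] E by auto
  next
    case True
    obtain g where g: "i = Suc g" "h \<le> g" using R.pos by (cases i) auto
    have im: "i < m" using B.a_pos[of i] True R.pos by simp
    \<comment> \<open>Row \<open>g\<close> of \<open>E\<close> has no bump in columns
      \<open>j + 1\<close> to \<open>k\<close>, so the path is still right of \<open>k\<close>
      there; this keeps the new path strictly decreasing.\<close>
    have row_g: "(g, c) \<in> E" if "j < c" "c \<le> k" for c
      using that R.full[of g c] R.pos g by (cases "g = h \<and> c = k") (auto simp: DE)
    have "j < b g" using B.a_dec[of g] im g True by simp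
    then have kg: "k < b g" using row_g[of "b g"] B.a_bump[of g] by (cases "k < b g") auto
    have bS: "b (Suc i) < j" using B.a_dec[OF im] True by simp
    define a where "a = b(i := k)"
    have p: "pipe_path (Suc n) m D a"
      unfolding pipe_path_def
    proof (intro conjI allI impI)
      show "a 0 = Suc n" using B.a0 g by (simp add: a_def)
      show "(0 < a r) = (r < m)" for r using B.a_pos[of r] im R.pos by (auto simp: a_def)
      show "a (Suc r) < a r" if "r < m" for r
        using B.a_dec[OF that] kg bS R.pos g by (auto simp: a_def)
      show "(r, a r) \<notin> D" for r
        using B.a_bump[of r] R.corners(3) DE[of r "b r"] by (cases "r = i") (simp_all add: a_def)
    qed
    interpret A: inserted n m D a using RP_staircase[OF D] p by unfold_locales
    have ah: "a h \<noteq> k" using bh R.pos by (simp add: a_def)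
    have s1: "ladder_step (insert_pipe a D) (insert_pipe a E)"
      using A.lift_ladder[OF R ah] E by simp
    have pE: "pipe_path (Suc n) m E a" using A.pipe_path_ladder[OF ah] E by simp
    interpret A': inserted n m E a using RP_staircase[OF ERP] pE by unfold_locales
    have i0: "0 < i" and ji: "j < a i" and ij: "(i, j) \<notin> E" and aS: "a (Suc i) < j"
      using R.pos bS DE by (auto simp: a_def)
    have row: "(i, c) \<in> E" if "j < c" "c < a i" for c
    proof -
      have "c < k" using that by (simp add: a_def)
      then have "(i, c) \<in> D" using that R.full[of i c] R.pos by simp
      then show ?thesis using DE that by simp
    qed
    have "a(i := j) = b" using True by (auto simp: a_def)
    then have s2: "ladder_step (insert_pipe a E) (insert_pipe b E)"
      using A'.shift_path(2,3)[OF i0 R.pos(3) ji ij aS row] by (auto simp: ladder_step_def)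
    show thesis by (rule that[OF p], rule rtranclp.rtrancl_into_rtrancl[OF r_into_rtranclp[of ladder_step, OF s1] s2])
  qed
qed

lemma pull_steps:
  assumes "ladder_step\<^sup>*\<^sup>* D E" "D \<in> RP n" "pipe_path (Suc n) m E b"
  obtains a where "pipe_path (Suc n) m D a" "ladder_step\<^sup>*\<^sup>* (insert_pipe a D) (insert_pipe b E)"
proof -
  have "\<exists>a. pipe_path (Suc n) m D a \<and> ladder_step\<^sup>*\<^sup>* (insert_pipe a D) (insert_pipe b E)"
    using assms(1,2)
  proof (induction rule: converse_rtranclp_induct)
    case base
    then show ?case using assms by blast
  next
    case (step D D')
    then obtain a where a: "pipe_path (Suc n) m D' a" "ladder_step\<^sup>*\<^sup>* (insert_pipe a D') (insert_pipe b E)"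
      using RP_step by blast
    obtain a' where "pipe_path (Suc n) m D a'" "ladder_step\<^sup>*\<^sup>* (insert_pipe a' D) (insert_pipe a D')"
      using pull_step[OF step(4) a(1) step(1)] .
    then show ?case using a(2) by (meson rtranclp_trans)
  qed
  then show thesis using that by blast
qed

text \<open>Lower bounds come from pulling paths down to a common \<open>M\<close>, joins from
  pushing them up to the join of the smaller pipe dreams. Equal exits express that \<open>X\<close>
  and \<open>Y\<close> have the same permutation.\<close>

lemma RP_bounds:
  assumes "X \<in> RP n" "Y \<in> RP n" "\<And>r. r \<le> n \<Longrightarrow> state X r 0 = state Y r 0"
  shows "(\<exists>M\<in>RP n. ladder_step\<^sup>*\<^sup>* M X \<and> ladder_step\<^sup>*\<^sup>* M Y) \<and>
    (\<exists>J. ladder_step\<^sup>*\<^sup>* X J \<and> ladder_step\<^sup>*\<^sup>* Y J \<and>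
      (\<forall>F. ladder_step\<^sup>*\<^sup>* X F \<longrightarrow> ladder_step\<^sup>*\<^sup>* Y F \<longrightarrow> ladder_step\<^sup>*\<^sup>* J F))"
  using assms
proof (induction n arbitrary: X Y)
  case 0
  then have "X = {}" "Y = {}" by (auto simp: RP_def staircase_def)
  then show ?case using 0 by blast
next
  case (Suc n)
  obtain m D a where D: "D \<in> RP n" "pipe_path (Suc n) m D a" "X = insert_pipe a D"
    using remove_pipe[OF Suc.prems(1)] .
  obtain m' E b where E: "E \<in> RP n" "pipe_path (Suc n) m' E b" "Y = insert_pipe b E"
    using remove_pipe[OF Suc.prems(2)] .
  interpret A: inserted n m D a using RP_staircase[OF D(1)] D(2) by unfold_locales
  interpret B: inserted n m' E b using RP_staircase[OF E(1)] E(2) by unfold_locales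
  have exX: "state X r 0 = (if r < m then state D r 0 else if r = m then Suc n else state D (r - 1) 0)"
    and exY: "state Y r 0 = (if r < m' then state E r 0 else if r = m' then Suc n else state E (r - 1) 0)"
    if "r \<le> Suc n" for r
    using A.exit_insert[OF that] B.exit_insert[OF that] D(3) E(3) by auto
  have le: "state D r 0 \<le> n" "state E r 0 \<le> n" if "r \<le> n" for r
    using state_bound[OF A.D, of 0 r] state_bound[OF B.D, of 0 r] that by auto
  \<comment> \<open>Pipe \<open>Suc n\<close> exits in row \<open>m\<close> of \<open>X\<close> and
    in row \<open>m'\<close> of \<open>Y\<close>, and the pipes of \<open>D\<close> and
    \<open>E\<close> have labels at most \<open>n\<close>; equal exits force equal rows.\<close>
  have "\<not> m < m'"
    using exX[of m] exY[of m] Suc.prems(3)[of m] le(2)[of m] A.m_le B.m_le by auto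
  moreover have "\<not> m' < m"
    using exX[of m'] exY[of m'] Suc.prems(3)[of m'] le(1)[of m'] A.m_le B.m_le by auto
  ultimately have mm: "m' = m" by simp
  have "state D r 0 = state E r 0" if "r \<le> n" for r
  proof (cases "r < m")
    case True
    then show ?thesis using exX[of r] exY[of r] Suc.prems(3)[of r] mm that by simp
  next
    case False
    then show ?thesis using exX[of "Suc r"] exY[of "Suc r"] Suc.prems(3)[of "Suc r"] mm that by simp
  qed
  note IH = Suc.IH[OF D(1) E(1) this]
  note E2 = E(2)[unfolded mm]
  show ?case
  proof (rule conjI)
    obtain M where M: "M \<in> RP n" "ladder_step\<^sup>*\<^sup>* M D" "ladder_step\<^sup>*\<^sup>* M E" using IH by blast
    obtain c where c: "pipe_path (Suc n) m M c" "ladder_step\<^sup>*\<^sup>* (insert_pipe c M) X"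
      using pull_steps[OF M(2,1) D(2)] D(3) by blast
    obtain d where d: "pipe_path (Suc n) m M d" "ladder_step\<^sup>*\<^sup>* (insert_pipe d M) Y"
      using pull_steps[OF M(3,1) E2] E(3) by blast
    \<comment> \<open>Moves in a fibre decrease the path, so the pointwise maximum yields an element
      below both.\<close>
    let ?e = "\<lambda>r. max (c r) (d r)"
    have e: "pipe_path (Suc n) m M ?e" using pipe_path_max c(1) d(1) by blast
    interpret C: inserted n m M ?e using RP_staircase[OF M(1)] e by unfold_locales
    have "ladder_step\<^sup>*\<^sup>* (insert_pipe ?e M) (insert_pipe c M)"
      "ladder_step\<^sup>*\<^sup>* (insert_pipe ?e M) (insert_pipe d M)"
      using fibre_steps[OF C.D e c(1)] fibre_steps[OF C.D e d(1)] by auto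
    then show "\<exists>M\<in>RP (Suc n). ladder_step\<^sup>*\<^sup>* M X \<and> ladder_step\<^sup>*\<^sup>* M Y"
      using C.insert_RP[OF M(1)] c(2) d(2) by (meson rtranclp_trans)
  next
    obtain J where J: "ladder_step\<^sup>*\<^sup>* D J" "ladder_step\<^sup>*\<^sup>* E J"
      and least: "\<And>F. ladder_step\<^sup>*\<^sup>* D F \<Longrightarrow> ladder_step\<^sup>*\<^sup>* E F \<Longrightarrow> ladder_step\<^sup>*\<^sup>* J F"
      using IH by blast
    have JRP: "J \<in> RP n" using RP_steps[OF J(1) D(1)] by blast
    obtain c where c: "pipe_path (Suc n) m J c" "ladder_step\<^sup>*\<^sup>* X (insert_pipe c J)"
      "\<And>F e. \<lbrakk>ladder_step\<^sup>*\<^sup>* J F; pipe_path (Suc n) m F e; \<And>r. west F r (e r) \<subseteq> west D r (a r)\<rbrakk> \<Longrightarrow>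
        \<forall>r. west F r (e r) \<subseteq> west J r (c r)"
      using push_steps[OF J(1) D(1,2)] D(3) by blast
    obtain d where d: "pipe_path (Suc n) m J d" "ladder_step\<^sup>*\<^sup>* Y (insert_pipe d J)"
      "\<And>F e. \<lbrakk>ladder_step\<^sup>*\<^sup>* J F; pipe_path (Suc n) m F e; \<And>r. west F r (e r) \<subseteq> west E r (b r)\<rbrakk> \<Longrightarrow>
        \<forall>r. west F r (e r) \<subseteq> west J r (d r)"
      using push_steps[OF J(2) E(1) E2] E(3) by blast
    \<comment> \<open>The pointwise minimum lies above both pushed paths in the fibre of
      \<open>J\<close>.\<close>
    let ?f = "\<lambda>r. min (c r) (d r)"
    have f: "pipe_path (Suc n) m J ?f" using pipe_path_min c(1) d(1) by blast
    have "ladder_step\<^sup>*\<^sup>* (insert_pipe c J) (insert_pipe ?f J)"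
      "ladder_step\<^sup>*\<^sup>* (insert_pipe d J) (insert_pipe ?f J)"
      using fibre_steps[OF RP_staircase[OF JRP] c(1) f] fibre_steps[OF RP_staircase[OF JRP] d(1) f] by auto
    then have up: "ladder_step\<^sup>*\<^sup>* X (insert_pipe ?f J)" "ladder_step\<^sup>*\<^sup>* Y (insert_pipe ?f J)"
      using c(2) d(2) by (meson rtranclp_trans)+
    have "ladder_step\<^sup>*\<^sup>* (insert_pipe ?f J) G" if G: "ladder_step\<^sup>*\<^sup>* X G" "ladder_step\<^sup>*\<^sup>* Y G" for G
    proof -
      obtain F e where F: "G = insert_pipe e F" "F \<in> RP n" "pipe_path (Suc n) m F e"
        "ladder_step\<^sup>*\<^sup>* D F" "\<And>r. west F r (e r) \<subseteq> west D r (a r)"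
        using project_steps[OF G(1) D(3,1,2)] by blast
      obtain F' e' where F': "G = insert_pipe e' F'" "F' \<in> RP n" "pipe_path (Suc n) m F' e'"
        "ladder_step\<^sup>*\<^sup>* E F'" "\<And>r. west F' r (e' r) \<subseteq> west E r (b r)"
        using project_steps[OF G(2) E(3,1) E2] by blast
      \<comment> \<open>Both chains end in the same \<open>G\<close>, whose decomposition is
        unique.\<close>
      have eq: "F' = F" "e' = e"
        using insert_pipe_inject[OF RP_staircase[OF F'(2)] RP_staircase[OF F(2)] F'(3) F(3)] F(1) F'(1)
        by auto
      have JF: "ladder_step\<^sup>*\<^sup>* J F" using least F(4) F'(4) eq by simp
      have "west F r (e r) \<subseteq> west J r (c r)" "west F r (e r) \<subseteq> west J r (d r)" for r
        using c(3)[OF JF F(3,5)] d(3)[OF JF F(3)] F'(5) eq by auto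
      then have wJ: "west F r (e r) \<subseteq> west J r (?f r)" for r by (simp add: min_def)
      \<comment> \<open>Pushing the candidate join on to \<open>F\<close> reaches a path
        \<open>g\<close> with \<open>e \<le> g\<close>; the rest of the chain to \<open>G\<close>
        stays in the fibre of \<open>F\<close>.\<close>
      obtain g where g: "pipe_path (Suc n) m F g" "ladder_step\<^sup>*\<^sup>* (insert_pipe ?f J) (insert_pipe g F)"
        "\<And>F' e. \<lbrakk>ladder_step\<^sup>*\<^sup>* F F'; pipe_path (Suc n) m F' e; \<And>r. west F' r (e r) \<subseteq> west J r (?f r)\<rbrakk> \<Longrightarrow>
          \<forall>r. west F' r (e r) \<subseteq> west F r (g r)"
        using push_steps[OF JF JRP f] by blast
      interpret G: inserted n m F g using RP_staircase[OF F(2)] g(1) by unfold_locales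
      interpret F: inserted n m F e using RP_staircase[OF F(2)] F(3) by unfold_locales
      have "west F r (e r) \<subseteq> west F r (g r)" for r using g(3)[OF _ F(3) wJ] by blast
      then have "e r \<le> g r" for r
        using west_subset_iff[OF F.finD, of "g r" r "e r"] F.a_zero[of r] G.a_pos[of r]
        by (cases "r < m") auto
      then have "ladder_step\<^sup>*\<^sup>* (insert_pipe g F) G"
        using fibre_steps[OF F.D g(1) F(3)] F(1) by simp
      then show ?thesis using g(2) by simp
    qed
    with up show "\<exists>J. ladder_step\<^sup>*\<^sup>* X J \<and> ladder_step\<^sup>*\<^sup>* Y J \<and>
      (\<forall>F. ladder_step\<^sup>*\<^sup>* X F \<longrightarrow> ladder_step\<^sup>*\<^sup>* Y F \<longrightarrow> ladder_step\<^sup>*\<^sup>* J F)" by blast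
  qed
qed

section \<open>Antisymmetry and transfer to \<open>RPD w\<close>\<close>

definition column_sum :: "pipe_dream \<Rightarrow> nat" where
  "column_sum D = sum snd D"

text \<open>A move carries one cross from column \<open>j\<close> to a column \<open>k\<close>
  further right; this potential yields antisymmetry.\<close>

lemma column_sum_step:
  assumes "finite D" "ladder_step D E"
  shows "column_sum D < column_sum E" "card E = card D"
proof -
  obtain h i j k where R: "ladder_rectangle D h i j k" and E: "E = ladder h i j k D"
    using assms(2) by (rule ladder_stepE)
  interpret rectangle D h i j k using assms(1) R by unfold_locales
  have D: "D = insert (i, j) (D - {(i, j)})" using corners by auto
  have "sum snd D = j + sum snd (D - {(i, j)})"
    by (subst D, subst sum.insert) (use finD in auto)
  moreover have "sum snd E = k + sum snd (D - {(i, j)})"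
    unfolding E ladder_def by (subst sum.insert) (use finD corners in auto)
  ultimately show "column_sum D < column_sum E" using pos by (simp add: column_sum_def)
  show "card E = card D"
    unfolding E ladder_def using finD corners by (simp add: card_Suc_Diff1 card_insert_if del: card_Diff_insert)
qed

lemma column_sum_steps:
  assumes "ladder_step\<^sup>*\<^sup>* D E" "D \<in> RP n"
  shows "(D = E \<or> column_sum D < column_sum E) \<and> card E = card D"
  using assms
proof (induction rule: rtranclp_induct)
  case (step E F)
  have "E \<in> RP n" using RP_steps step by blast
  then show ?case using column_sum_step[OF RP_finite[OF \<open>E \<in> RP n\<close>] step(2)] step by auto
qed simp

text \<open>Moves preserve the exits and the number of crosses. Both directions are used: upwards
  for joins, downwards for common lower bounds known only to lie in \<open>RP n\<close>.\<close>

lemma RPD_steps_iff: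
  assumes D: "D \<in> RP n" and steps: "ladder_step\<^sup>*\<^sup>* D E"
  shows "E \<in> RPD w \<longleftrightarrow> D \<in> RPD w"
proof -
  have E: "E \<in> RP n" using RP_steps[OF steps D] by blast
  have pd: "is_pipe_dream X" if "X \<in> RP n" for X
    using RP_finite[OF that] RP_staircase[OF that] by (auto simp: is_pipe_dream_def staircase_def)
  have "state E r 0 = state D r 0" for r
    using RP_steps[OF steps D] by blast
  then have "has_permutation E w \<longleftrightarrow> has_permutation D w"
    using has_permutation_iff[OF pd[OF D]] has_permutation_iff[OF pd[OF E]] by simp
  then show ?thesis
    using column_sum_steps[OF steps D] pd D E by (simp add: RPD_def)
qed

lemma ladder_move_rtranclp_iff:
  assumes w: "w permutes {1..n}" and D: "D \<in> RPD w"
  shows "(ladder_move w)\<^sup>*\<^sup>* D E \<longleftrightarrow> ladder_step\<^sup>*\<^sup>* D E"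
proof
  have "ladder_step D' E'" if "ladder_move w D' E'" for D' E'
    using that by (auto simp: ladder_move_def ladder_step_def ladder_def)
  then show "ladder_step\<^sup>*\<^sup>* D E" if "(ladder_move w)\<^sup>*\<^sup>* D E"
    using that by (metis mono_rtranclp)
next
  assume "ladder_step\<^sup>*\<^sup>* D E"
  then show "(ladder_move w)\<^sup>*\<^sup>* D E"
  proof (induction rule: rtranclp_induct)
    case (step E F)
    have "E \<in> RPD w" using RPD_steps_iff[OF RPD_subset_RP[OF w D] step(1)] D by simp
    then have "ladder_move w E F"
      using step(2) by (auto simp: ladder_move_def ladder_step_def ladder_def)
    with step.IH show ?case by simp
  qed simp
qed

theorem theorem1p1:
  fixes n :: nat and w :: "nat \<Rightarrow> nat"
  assumes "n \<ge> 1"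
    and "w permutes {1..n}"
  shows "lattice (RPD_poset w)"
proof -
  note RP = RPD_subset_RP[OF assms(2)]
  let ?L = "RPD_poset w"
  let ?le = "ladder_step\<^sup>*\<^sup>*"
  have car: "carrier ?L = RPD w" by (simp add: RPD_poset_def)
  have le: "x \<sqsubseteq>\<^bsub>?L\<^esub> y \<longleftrightarrow> ?le x y" if "x \<in> RPD w" for x y
    using ladder_move_rtranclp_iff[OF assms(2) that] by (simp add: RPD_poset_def)
  have antisym: "x = y" if "x \<in> RPD w" "y \<in> RPD w" "?le x y" "?le y x" for x y
    using column_sum_steps[OF that(3) RP[OF that(1)]] column_sum_steps[OF that(4) RP[OF that(2)]] by auto
  have closed: "F \<in> RPD w" if "x \<in> RPD w" "?le x F" for x F
    using RPD_steps_iff[OF RP[OF that(1)] that(2)] that(1) by simp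
  interpret partial_order ?L
  proof unfold_locales
    show "x .=\<^bsub>?L\<^esub> y" if "x \<sqsubseteq>\<^bsub>?L\<^esub> y" "y \<sqsubseteq>\<^bsub>?L\<^esub> x" "x \<in> carrier ?L" "y \<in> carrier ?L" for x y
      using that antisym le car by (simp add: RPD_poset_def)
  qed (auto simp: RPD_poset_def)
  have exits: "state x r 0 = state y r 0" if "x \<in> RPD w" "y \<in> RPD w" for x y r
  proof (cases r)
    case (Suc s)
    have "w r = state z r 0" if "z \<in> RPD w" for z
      using that has_permutation_iff[of z w] Suc by (simp add: RPD_def del: state.simps)
    from this[of x] this[of y] show ?thesis using that by simp
  qed simp
  have bounds: "(\<exists>M\<in>RPD w. ?le M x \<and> ?le M y) \<and>
      (\<exists>J\<in>RPD w. ?le x J \<and> ?le y J \<and> (\<forall>F\<in>RPD w. ?le x F \<longrightarrow> ?le y F \<longrightarrow> ?le J F))"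
    if xy: "x \<in> RPD w" "y \<in> RPD w" for x y
  proof -
    note b = RP_bounds[OF RP[OF xy(1)] RP[OF xy(2)] exits[OF xy]]
    obtain M where M: "M \<in> RP n" "?le M x" "?le M y" using b by blast
    have "M \<in> RPD w" using RPD_steps_iff[OF M(1,2)] xy by simp
    moreover obtain J where J: "?le x J" "?le y J" "\<And>F. ?le x F \<Longrightarrow> ?le y F \<Longrightarrow> ?le J F"
      using b by blast
    moreover have "J \<in> RPD w" using closed xy(1) J(1) .
    ultimately show ?thesis using M by blast
  qed
  show ?thesis
  proof unfold_locales
    fix x y assume xy: "x \<in> carrier ?L" "y \<in> carrier ?L"
    then have xy': "x \<in> RPD w" "y \<in> RPD w" by (simp_all add: car)
    obtain J where J: "J \<in> RPD w" "?le x J" "?le y J"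
      "\<And>F. F \<in> RPD w \<Longrightarrow> ?le x F \<Longrightarrow> ?le y F \<Longrightarrow> ?le J F"
      using bounds[OF xy'] by blast
    show "\<exists>s. least ?L s (Upper ?L {x, y})"
      by (rule exI[of _ J]) (use J xy' le car in \<open>auto simp: least_def Upper_def\<close>)
    \<comment> \<open>The meet is a common lower bound \<open>g\<close> of maximal column sum: the
      join of \<open>g\<close> with any other common lower bound is again one, hence equals
      \<open>g\<close>.\<close>
    define B where "B = {M \<in> RPD w. ?le M x \<and> ?le M y}"
    have "B \<subseteq> Pow (staircase n)" using RP RP_staircase by (auto simp: B_def)
    then have "finite B" by (rule finite_subset) (simp add: finite_staircase)
    moreover have "B \<noteq> {}" using bounds[OF xy'] by (auto simp: B_def)
    ultimately have "Max (column_sum ` B) \<in> column_sum ` B"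
      and "\<And>M. M \<in> B \<Longrightarrow> column_sum M \<le> Max (column_sum ` B)"
      by simp_all
    then obtain g where g: "g \<in> B" "\<And>M. M \<in> B \<Longrightarrow> column_sum M \<le> column_sum g"
      by auto
    have "?le M g" if M: "M \<in> B" for M
    proof -
      have Mg: "M \<in> RPD w" "g \<in> RPD w" using M g by (auto simp: B_def)
      obtain J where J: "J \<in> RPD w" "?le M J" "?le g J"
        "\<And>F. F \<in> RPD w \<Longrightarrow> ?le M F \<Longrightarrow> ?le g F \<Longrightarrow> ?le J F"
        using bounds[OF Mg] by blast
      then have "J \<in> B" using M g xy' by (auto simp: B_def)
      then have "\<not> column_sum g < column_sum J" using g(2) by (simp add: not_less)
      then have "J = g" using column_sum_steps[OF J(3) RP[OF Mg(2)]] by auto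
      then show ?thesis using J(2) by simp
    qed
    then show "\<exists>s. greatest ?L s (Lower ?L {x, y})"
      using g(1) xy' le car by (intro exI[of _ g]) (auto simp: greatest_def Lower_def B_def)
  qed
qed

end
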